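(* Let $\mathcal{X}\in\mathcal{H}^{m\times p}$ with a q-SVD $\mathcal{X}=\mathcal{U}\star_F\mathcal{S}\star_F\mathcal{V}^*$, and let $q\in\mathbb{N}$ be a finite integer. Define the explicit rank $q$ truncation of $\mathcal{X}$ as the quasitubal tensor $$\mathcal{X}_{[q]}=\sum_{n=1}^q\widehat{s}^{(t_n)}_{l_n}\,\phi^{(t_n)}\star_F\mathcal{U}_{:,l_n}\star_F\mathcal{V}_{:,l_n}^*,$$ where the mapping $n\mapsto(l_n,t_n)$ is a one-to-one mapping from $\mathbb{N}=\{1,2,\dots\}$ onto a subset of $\{1,\dots,\min(m,p)\}\times\mathbb{Z}$ such that $$\widehat{s}^{(t_1)}_{l_1}\geq\widehat{s}^{(t_2)}_{l_2}\geq\cdots\geq\widehat{s}^{(t_q)}_{l_q}\geq\widehat{s}^{(t_{q+1})}_{l_{q+1}}\geq\cdots\geq 0,\qquad\text{with }\widehat{s}^{(t)}_l=\widehat{\mathcal{S}}_{l,l,t}.$$ Then $\operatorname{rank}_{\mathbb{F},\star_F}\mathcal{X}_{[q]}\leq q$. Moreover, for all $\mathcal{Y}\in\mathcal{H}^{m\times p}$ with $\operatorname{rank}_{\mathbb{F},\star_F}\mathcal{Y}\leq q$, $$\|\mathcal{X}-\mathcal{X}_{[q]}\|_{\mathcal{H}}\leq\|\mathcal{X}-\mathcal{Y}\|_{\mathcal{H}},$$ that is, $\mathcal{X}_{[q]}$ is an optimal implicit rank $q$ approximation of $\mathcal{X}$ in $\|\cdot\|_{\mathcal{H}}$. Finally,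 $\lim_{q\to\infty}\|\mathcal{X}-\mathcal{X}_{[q]}\|_{\mathrm{op}}=\lim_{q\to\infty}\|\mathcal{X}-\mathcal{X}_{[q]}\|_{\mathcal{H}}=0$.
   Context: $\mathbb{F}$ is $\mathbb{R}$ or $\mathbb{C}$; $m,p$ are positive integers. $\mathcal{H}$ is a separable infinite-dimensional Hilbert space over $\mathbb{F}$ (inner product linear in the first argument) with a fixed orthonormal basis $F=\{\phi^{(j)}\}_{j\in\mathbb{Z}}$. For $x\in\mathcal{H}$ put $\widehat{x}_j=\langle x,\phi^{(j)}\rangle_{\mathcal{H}}$, and define $x\star_F y=\sum_{j}\widehat{x}_j\widehat{y}_j\phi^{(j)}\in\mathcal{H}$. A map $T:\mathcal{H}\to\mathcal{H}$ is $\mathcal{H}$-linear if $T(a\star_F x+b\star_F y)=a\star_F T(x)+b\star_F T(y)$ for all $a,b,x,y\in\mathcal{H}$. A quasitube is a bounded $\mathcal{H}$-linear operator on $\mathcal{H}$; $\mathcal{H}_*$ is the set of quasitubes, a commutative unital C*-algebra over $\mathbb{F}$ under composition (also written $\star_F$), Hilbert space adjoint and operator norm, with unit $e$. The map $\pi(q)=(\langle q(\phi^{(j)}),\phi^{(j)}\rangle_{\mathcal{H}})_{j\in\mathbb{Z}}$ is an isometric *-isomorphism of $\mathcal{H}_*$ onto $\ell_\infty(\mathbb{Z})$. $\mathcal{H}$ is regarded as a subset of $\mathcal{H}_*$ by identifying $x\in\mathcal{H}$ with the quasitube $y\mapsto x\star_F y$ (so $\pi(x)=\widehat{x}$); thus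 $\mathcal{H}^{m\times p}\subset\mathcal{H}_*^{m\times p}$. For $a,b\in\mathcal{H}_*$, $a\geq_{\mathcal{H}_*}b$ means that $a-b$ is self-adjoint with spectrum contained in $[0,\infty)$; equivalently all entries of $\pi(a-b)$ are non-negative reals. An $m\times p$ quasitubal tensor is a matrix $\mathcal{X}=(x_{ij})\in\mathcal{H}_*^{m\times p}$; for $k\in\mathbb{Z}$, $\widehat{\mathcal{X}}_{:,:,k}\in\mathbb{F}^{m\times p}$ is the matrix with entries $\widehat{\mathcal{X}}_{i,j,k}=\pi(x_{ij})_k$. $\mathcal{X}\star_F\mathcal{Y}$ has slices $\widehat{\mathcal{X}}_{:,:,k}\widehat{\mathcal{Y}}_{:,:,k}$; $\mathcal{X}^*$ has slices $(\widehat{\mathcal{X}}_{:,:,k})^{\mathrm{H}}$ (conjugate transpose); the product of a quasitube with a quasitubal tensor is entrywise; the identity tensor $\mathcal{I}$ has $e$ on the diagonal and $0$ elsewhere; a square $\mathcal{U}$ is $\star_F$-unitary if $\mathcal{U}^*\star_F\mathcal{U}=\mathcal{U}\star_F\mathcal{U}^*=\mathcal{I}$; $\mathcal{S}$ is f-diagonal if all $\widehat{\mathcal{S}}_{:,:,k}$ are (rectangular) diagonal. $\mathcal{U}_{:,l}$ denotes the $l$-th column of $\mathcal{U}$, and $\mathcal{V}_{:,l}^*$ is the conjugate transpose of the $l$-th column of $\mathcal{V}$. A q-SVD of $\mathcal{X}$ is a factorization $\mathcal{X}=\mathcal{U}\star_F\mathcal{S}\star_F\mathcal{V}^*$ with $\mathcal{U}\in\mathcal{H}_*^{m\times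 m}$, $\mathcal{V}\in\mathcal{H}_*^{p\times p}$ $\star_F$-unitary and $\mathcal{S}\in\mathcal{H}_*^{m\times p}$ f-diagonal with diagonal entries $s_1\geq_{\mathcal{H}_*}\cdots\geq_{\mathcal{H}_*}s_{\min(m,p)}\geq_{\mathcal{H}_*}0$. Norms: $\|\mathcal{A}\|_{\mathcal{H}}^2=\sum_{i,j}\|a_{ij}\|_{\mathcal{H}}^2$ for $\mathcal{A}\in\mathcal{H}^{m\times p}$; $\|\mathcal{B}\|_{\mathrm{op}}=\sup\{\|\mathcal{B}\star_F X\|_{\mathcal{H}}: X\in\mathcal{H}^p,\ \|X\|_{\mathcal{H}}=1\}$ for $\mathcal{B}\in\mathcal{H}_*^{m\times p}$. Rank: $\operatorname{rank}_{\mathbb{F},\star_F}\mathcal{Y}$ is the dimension, as a vector space over $\mathbb{F}$, of the image $\{\mathcal{Y}\star_F Z: Z\in\mathcal{H}_*^p\}\subseteq\mathcal{H}_*^m$ of the $\mathcal{H}_*$-linear map represented by $\mathcal{Y}$. The implicit rank of $\mathcal{Y}$ is the (possibly infinite) number of pairs $(l,t)\in\{1,\dots,\min(m,p)\}\times\mathbb{Z}$ for which the entry $(l,l,t)$ of the transformed f-diagonal factor in a q-SVD of $\mathcal{Y}$ is nonzero; the paper identifies it with $\operatorname{rank}_{\mathbb{F},\star_F}\mathcal{Y}$.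
   Formalization: The mapping n ↦ (l_n,t_n) is additionally required to reach every pair (l,t) with nonzero singular value; without this the largest singular values could be omitted and the optimality and limit claims would fail. *)

theory Defs
  imports
    "HOL-Analysis.Infinite_Sum"
    "HOL-Library.Function_Algebras"
    "HOL-Library.Extended_Nat"
    "Jordan_Normal_Form.Schur_Decomposition"
begin

text \<open>
  The class of scalar fields \<open>F\<close> that are (isometrically and \<open>*\<close>-isomorphic to) the real or the
  complex numbers. The order is the usual one on the reals and the one of
  \<^theory>\<open>HOL-Library.Complex_Order\<close> on the complex numbers; in both cases \<open>0 \<le> c\<close> says that \<open>c\<close>
  is a non-negative real number.
\<close>

class real_or_complex = real_normed_field + conjugatable_ordered_field +
  assumes real_or_complex:
    "\<exists>h :: 'a \<Rightarrow> complex.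
       (\<forall>x y. h (x + y) = h x + h y) \<and> (\<forall>x y. h (x * y) = h x * h y) \<and>
       (\<forall>r. h (r *\<^sub>R 1) = complex_of_real r) \<and>
       (\<forall>x. h (conjugate x) = cnj (h x)) \<and> (\<forall>x. norm (h x) = norm x) \<and>
       (\<forall>x y. x \<le> y \<longleftrightarrow> h x \<le> h y) \<and>
       (range h = \<real> \<or> range h = UNIV)"

instance real :: real_or_complex
  by standard
    (rule exI[of _ complex_of_real], simp add: less_eq_complex_def flip: Reals_def)

instance complex :: real_or_complex
  by standard (rule exI[of _ "\<lambda>x. x"], simp add: scaleR_conv_of_real)


text \<open>
  A Hilbert space over \<open>F\<close> with a fixed orthonormal basis indexed by the integers. The topology is
  that of the type \<open>'h\<close>, of class \<^class>\<open>banach\<close>; its norm is required below to be the one induced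
  by the inner product, so that completeness is part of the type class. Separability and infinite
  dimension follow from the existence of the basis.
\<close>

record ('f, 'h) based_space =
  smul :: "'f \<Rightarrow> 'h \<Rightarrow> 'h"
  ip :: "'h \<Rightarrow> 'h \<Rightarrow> 'f"
  bas :: "int \<Rightarrow> 'h"

definition based_hilbert_space :: "('f::real_or_complex, 'h::banach) based_space \<Rightarrow> bool" where
  "based_hilbert_space H \<longleftrightarrow>
     vector_space (smul H) \<and>
     (\<forall>r x. smul H (of_real r) x = r *\<^sub>R x) \<and>
     (\<forall>x y z. ip H (x + y) z = ip H x z + ip H y z) \<and>
     (\<forall>c x y. ip H (smul H c x) y = c * ip H x y) \<and>
     (\<forall>x y. ip H y x = conjugate (ip H x y)) \<and>
     (\<forall>x. ip H x x = of_real ((norm x)\<^sup>2)) \<and>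
     (\<forall>i j. ip H (bas H i) (bas H j) = (if i = j then 1 else 0)) \<and>
     closure (Modules.module.span (smul H) (range (bas H))) = UNIV"

definition coef :: "('f::real_or_complex, 'h::banach) based_space \<Rightarrow> 'h \<Rightarrow> int \<Rightarrow> 'f" where
  "coef H x j = ip H x (bas H j)"

definition star :: "('f::real_or_complex, 'h::banach) based_space \<Rightarrow> 'h \<Rightarrow> 'h \<Rightarrow> 'h" where
  "star H x y = (\<Sum>\<^sub>\<infinity>j\<in>UNIV. smul H (coef H x j * coef H y j) (bas H j))"


subsection \<open>Quasitubes\<close>

text \<open>
  Linearity over \<open>F\<close> is not listed: it follows from boundedness and
  \<open>H\<close>-linearity. The product of quasitubes is composition, the unit is \<^const>\<open>id\<close>, and sums,
  differences and zero are the pointwise ones of \<^theory>\<open>HOL-Library.Function_Algebras\<close>.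
  An element \<open>x\<close> of the Hilbert space is regarded as the quasitube \<open>star H x\<close>.
\<close>

definition quasitubes :: "('f::real_or_complex, 'h::banach) based_space \<Rightarrow> ('h \<Rightarrow> 'h) set" where
  "quasitubes H = {T.
     (\<forall>a b x y. T (star H a x + star H b y) = star H a (T x) + star H b (T y)) \<and>
     (\<exists>K. \<forall>x. norm (T x) \<le> K * norm x)}"

definition tube_coef :: "('f::real_or_complex, 'h::banach) based_space \<Rightarrow> ('h \<Rightarrow> 'h) \<Rightarrow> int \<Rightarrow> 'f"
  where "tube_coef H q = (\<lambda>j. ip H (q (bas H j)) (bas H j))"

text \<open>The inverse of the isomorphism onto the bounded sequences; junk on unbounded sequences.\<close>

definition tube_of_coef :: "('f::real_or_complex, 'h::banach) based_space \<Rightarrow> (int \<Rightarrow> 'f) \<Rightarrow> 'h \<Rightarrow> 'h"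
  where "tube_of_coef H = the_inv_into (quasitubes H) (tube_coef H)"

definition tube_selfadjoint :: "('f::real_or_complex, 'h::banach) based_space \<Rightarrow> ('h \<Rightarrow> 'h) \<Rightarrow> bool"
  where "tube_selfadjoint H q \<longleftrightarrow> (\<forall>x y. ip H (q x) y = ip H x (q y))"

definition tube_spectrum :: "('f::real_or_complex, 'h::banach) based_space \<Rightarrow> ('h \<Rightarrow> 'h) \<Rightarrow> 'f set"
  where "tube_spectrum H q =
    {c. \<not> (\<exists>r\<in>quasitubes H. r \<circ> (\<lambda>x. q x - smul H c x) = id \<and> (\<lambda>x. q x - smul H c x) \<circ> r = id)}"

definition tube_ge ::
    "('f::real_or_complex, 'h::banach) based_space \<Rightarrow> ('h \<Rightarrow> 'h) \<Rightarrow> ('h \<Rightarrow> 'h) \<Rightarrow> bool"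
  where "tube_ge H a b \<longleftrightarrow> tube_selfadjoint H (a - b) \<and> tube_spectrum H (a - b) \<subseteq> {c. 0 \<le> c}"


subsection \<open>Quasitubal tensors\<close>

text \<open>Row and column indices of tensors start at 0.\<close>

definition quasi_tensors ::
    "('f::real_or_complex, 'h::banach) based_space \<Rightarrow> nat \<Rightarrow> nat \<Rightarrow> ('h \<Rightarrow> 'h) mat set"
  where "quasi_tensors H m p = {X \<in> carrier_mat m p. elements_mat X \<subseteq> quasitubes H}"

definition hilbert_tensors ::
    "('f::real_or_complex, 'h::banach) based_space \<Rightarrow> nat \<Rightarrow> nat \<Rightarrow> ('h \<Rightarrow> 'h) mat set"
  where "hilbert_tensors H m p = {X \<in> carrier_mat m p. elements_mat X \<subseteq> range (star H)}"

definition slice :: "('f::real_or_complex, 'h::banach) based_space \<Rightarrow> ('h \<Rightarrow> 'h) mat \<Rightarrow> int \<Rightarrow> 'f mat"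
  where "slice H X k = map_mat (\<lambda>q. tube_coef H q k) X"

definition tensor_of_slices ::
    "('f::real_or_complex, 'h::banach) based_space \<Rightarrow> nat \<Rightarrow> nat \<Rightarrow> (int \<Rightarrow> 'f mat) \<Rightarrow> ('h \<Rightarrow> 'h) mat"
  where "tensor_of_slices H m p A = mat m p (\<lambda>(i, j). tube_of_coef H (\<lambda>k. A k $$ (i, j)))"

definition tmult ::
    "('f::real_or_complex, 'h::banach) based_space \<Rightarrow> ('h \<Rightarrow> 'h) mat \<Rightarrow> ('h \<Rightarrow> 'h) mat \<Rightarrow> ('h \<Rightarrow> 'h) mat"
  where "tmult H X Y =
    tensor_of_slices H (dim_row X) (dim_col Y) (\<lambda>k. slice H X k * slice H Y k)"

definition tadjoint ::
    "('f::real_or_complex, 'h::banach) based_space \<Rightarrow> ('h \<Rightarrow> 'h) mat \<Rightarrow> ('h \<Rightarrow> 'h) mat"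
  where "tadjoint H X =
    tensor_of_slices H (dim_col X) (dim_row X) (\<lambda>k. mat_adjoint (slice H X k))"

definition tube_times_tensor :: "('h \<Rightarrow> 'h) \<Rightarrow> ('h \<Rightarrow> 'h) mat \<Rightarrow> ('h \<Rightarrow> 'h) mat"
  where "tube_times_tensor a X = map_mat (\<lambda>q. a \<circ> q) X"

definition tensor_id :: "nat \<Rightarrow> ('h::banach \<Rightarrow> 'h) mat"
  where "tensor_id m = mat m m (\<lambda>(i, j). if i = j then id else 0)"

definition tensor_col :: "('h \<Rightarrow> 'h) mat \<Rightarrow> nat \<Rightarrow> ('h \<Rightarrow> 'h) mat"
  where "tensor_col X l = mat (dim_row X) 1 (\<lambda>(i, _). X $$ (i, l))"

definition tensor_unitary ::
    "('f::real_or_complex, 'h::banach) based_space \<Rightarrow> nat \<Rightarrow> ('h \<Rightarrow> 'h) mat \<Rightarrow> bool"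
  where "tensor_unitary H m U \<longleftrightarrow> U \<in> quasi_tensors H m m \<and>
    tmult H (tadjoint H U) U = tensor_id m \<and> tmult H U (tadjoint H U) = tensor_id m"

definition f_diagonal :: "('f::real_or_complex, 'h::banach) based_space \<Rightarrow> ('h \<Rightarrow> 'h) mat \<Rightarrow> bool"
  where "f_diagonal H S \<longleftrightarrow> (\<forall>k. diagonal_mat (slice H S k))"

definition qsvd :: "('f::real_or_complex, 'h::banach) based_space \<Rightarrow> nat \<Rightarrow> nat \<Rightarrow>
    ('h \<Rightarrow> 'h) mat \<Rightarrow> ('h \<Rightarrow> 'h) mat \<Rightarrow> ('h \<Rightarrow> 'h) mat \<Rightarrow> ('h \<Rightarrow> 'h) mat \<Rightarrow> bool"
  where "qsvd H m p X U S V \<longleftrightarrow>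
    X = tmult H (tmult H U S) (tadjoint H V) \<and>
    tensor_unitary H m U \<and> tensor_unitary H p V \<and>
    S \<in> quasi_tensors H m p \<and> f_diagonal H S \<and>
    (\<forall>l. Suc l < min m p \<longrightarrow> tube_ge H (S $$ (l, l)) (S $$ (Suc l, Suc l))) \<and>
    tube_ge H (S $$ (min m p - 1, min m p - 1)) 0"

definition sing_val ::
    "('f::real_or_complex, 'h::banach) based_space \<Rightarrow> ('h \<Rightarrow> 'h) mat \<Rightarrow> nat \<times> int \<Rightarrow> 'f"
  where "sing_val H S = (\<lambda>(l, t). slice H S t $$ (l, l))"


subsection \<open>Norms\<close>

text \<open>
  \<open>tensor_norm\<close> is meaningful only for tensors in \<^const>\<open>hilbert_tensors\<close>: it uses the unique \<open>x\<close> with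
  \<open>star H x\<close> equal to the entry.
\<close>

definition tensor_norm :: "('f::real_or_complex, 'h::banach) based_space \<Rightarrow> ('h \<Rightarrow> 'h) mat \<Rightarrow> real"
  where "tensor_norm H A =
    sqrt (\<Sum>i<dim_row A. \<Sum>j<dim_col A. (norm (the_inv (star H) (A $$ (i, j))))\<^sup>2)"

definition tensor_op_norm :: "('f::real_or_complex, 'h::banach) based_space \<Rightarrow> ('h \<Rightarrow> 'h) mat \<Rightarrow> real"
  where "tensor_op_norm H B =
    (SUP Z\<in>{Z \<in> hilbert_tensors H (dim_col B) 1. tensor_norm H Z = 1}. tensor_norm H (tmult H B Z))"


subsection \<open>Rank\<close>

text \<open>
  An \<open>m \<times> 1\<close> tensor is encoded as a function on row indices that is zero from \<open>m\<close> on, so that the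
  image of \<open>Y\<close> becomes a subset of a type with a vector space structure over \<open>F\<close>. The case
  distinction is needed because \<^const>\<open>Vector_Spaces.vector_space.dim\<close> is 0 in the infinite-dimensional case.
\<close>

definition tensor_image ::
    "('f::real_or_complex, 'h::banach) based_space \<Rightarrow> ('h \<Rightarrow> 'h) mat \<Rightarrow> (nat \<Rightarrow> 'h \<Rightarrow> 'h) set"
  where "tensor_image H Y =
    (\<lambda>Z i. if i < dim_row Y then tmult H Y Z $$ (i, 0) else 0) ` quasi_tensors H (dim_col Y) 1"

definition column_smul ::
    "('f::real_or_complex, 'h::banach) based_space \<Rightarrow> 'f \<Rightarrow> (nat \<Rightarrow> 'h \<Rightarrow> 'h) \<Rightarrow> (nat \<Rightarrow> 'h \<Rightarrow> 'h)"
  where "column_smul H c f = (\<lambda>i x. smul H c (f i x))"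

definition tensor_rank :: "('f::real_or_complex, 'h::banach) based_space \<Rightarrow> ('h \<Rightarrow> 'h) mat \<Rightarrow> enat"
  where "tensor_rank H Y =
    (if \<exists>B. finite B \<and> tensor_image H Y \<subseteq> Modules.module.span (column_smul H) B
     then enat (Vector_Spaces.vector_space.dim (column_smul H) (tensor_image H Y)) else \<infinity>)"


subsection \<open>Explicit rank truncation\<close>

text \<open>
  An enumeration of the singular values is a map \<open>n \<mapsto> (l\<^sub>n, t\<^sub>n)\<close>, used for \<open>n \<ge> 1\<close>. Besides
  injectivity and monotonicity, every pair with a nonzero singular value has to occur: otherwise
  the largest singular values could be left out.
\<close>

definition sing_val_enum :: "('f::real_or_complex, 'h::banach) based_space \<Rightarrow> nat \<Rightarrow> nat \<Rightarrow>
    ('h \<Rightarrow> 'h) mat \<Rightarrow> (nat \<Rightarrow> nat \<times> int) \<Rightarrow> bool"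
  where "sing_val_enum H m p S idx \<longleftrightarrow>
    inj_on idx {1..} \<and> idx ` {1..} \<subseteq> {..<min m p} \<times> UNIV \<and>
    (\<forall>n\<ge>1. sing_val H S (idx (Suc n)) \<le> sing_val H S (idx n)) \<and>
    (\<forall>n\<ge>1. 0 \<le> sing_val H S (idx n)) \<and>
    {lt \<in> {..<min m p} \<times> UNIV. sing_val H S lt \<noteq> 0} \<subseteq> idx ` {1..}"

definition trunc_term :: "('f::real_or_complex, 'h::banach) based_space \<Rightarrow>
    ('h \<Rightarrow> 'h) mat \<Rightarrow> ('h \<Rightarrow> 'h) mat \<Rightarrow> ('h \<Rightarrow> 'h) mat \<Rightarrow> nat \<times> int \<Rightarrow> ('h \<Rightarrow> 'h) mat"
  where "trunc_term H U S V = (\<lambda>(l, t).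
    tmult H
      (tube_times_tensor (star H (smul H (sing_val H S (l, t)) (bas H t))) (tensor_col U l))
      (tadjoint H (tensor_col V l)))"

definition truncation :: "('f::real_or_complex, 'h::banach) based_space \<Rightarrow> ('h \<Rightarrow> 'h) mat \<Rightarrow>
    ('h \<Rightarrow> 'h) mat \<Rightarrow> ('h \<Rightarrow> 'h) mat \<Rightarrow> (nat \<Rightarrow> nat \<times> int) \<Rightarrow> nat \<Rightarrow> ('h \<Rightarrow> 'h) mat"
  where "truncation H U S V idx q =
    mat (dim_row U) (dim_row V) (\<lambda>ij. \<Sum>n=1..q. trunc_term H U S V (idx n) $$ ij)"

end

theory Submission
  imports Defs "HOL-Analysis.Elementary_Normed_Spaces" "HOL-Analysis.L2_Norm"
begin

text \<open>
  The Frobenius norm of a tensor splits over slices, and the unitary factors leave each slice norm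
  unchanged, so \<open>\<parallel>X - X\<^sub>q\<parallel>\<^sup>2\<close> is the sum of the squared singular values beyond the first \<open>q\<close>. For the
  converse, let \<open>Y\<close> have rank at most \<open>q\<close>. Restricted to finitely many slices, the image of \<open>Y\<close> is
  spanned by an orthonormal system \<open>W\<close> of at most \<open>q\<close> vectors. If \<open>u\<close> and \<open>v\<close> are the singular vectors
  for the singular value \<open>s\<close>, then \<open>Y v\<close> lies in the span of \<open>W\<close>, so
  \<open>\<parallel>(X - Y) v\<parallel>\<^sup>2 = \<parallel>s u - Y v\<parallel>\<^sup>2 \<ge> s\<^sup>2 (1 - c)\<close> where \<open>c \<le> 1\<close> is the squared norm of the projection of \<open>u\<close>
  to that span. By Bessel's inequality the weights \<open>c\<close> sum to at most \<open>q\<close>, and since the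
  singular values are arranged in decreasing order, the sum of \<open>s\<^sup>2 (1 - c)\<close> is smallest when the
  weights are concentrated on the first \<open>q\<close> of them.
\<close>

section \<open>Scalars\<close>

text \<open>The rank bound is global: it limits the total rank of all slices without saying how it
  is distributed among them, so applying the best-approximation theorem for matrices slice by slice
  would leave this allocation open. Columns are therefore treated as single vectors indexed by pairs
  (row, slice). Singular vectors from different slices become orthogonal by disjoint supports, and a
  column that carries \<open>v\<close> in one slice only shows that \<open>Y v\<close>, extended by
  0, belongs to the image of \<open>Y\<close>. No decomposition of \<open>Y\<close> itself is used.

  The weights are row and column sums of one matrix, the squared inner products between the vectors
  \<open>u\<close> and the elements of \<open>W\<close>. Bessel's inequality is applied in both
  directions: with \<open>W\<close> as the orthonormal system it gives \<open>c \<le> 1\<close>,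
  with the vectors \<open>u\<close> as the system it gives the bound \<open>q\<close> on the sum.

  Only \<open>V\<close> is used to rotate a slice, which writes its norm as a sum over right
  singular vectors; \<open>U\<close> enters through the orthonormality of its columns. Keeping the
  first \<open>N\<close> singular values makes all of this finite-dimensional, and \<open>N\<close>
  tends to infinity only at the end.\<close>

context
  fixes x y :: "'a::real_or_complex"
begin

text \<open>The class supplies an additive isometric embedding \<open>h\<close> into the complex
  numbers. Isometry makes \<open>h\<close> injective, so an identity can be checked after applying
  \<open>h\<close>.\<close>

lemma mult_conjugate_self: "x * conjugate x = of_real ((norm x)\<^sup>2)"
  and norm_conjugate [simp]: "norm (conjugate x) = norm x"
  and norm_mono_nonneg: "0 \<le> x \<Longrightarrow> x \<le> y \<Longrightarrow> norm x \<le> norm y"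
  and conjugate_of_real [simp]: "conjugate (of_real r :: 'a) = of_real r"
proof -
  obtain h :: "'a \<Rightarrow> complex" where
    add: "\<And>x y. h (x + y) = h x + h y" and mult: "\<And>x y. h (x * y) = h x * h y"
    and scale: "\<And>r. h (r *\<^sub>R 1) = complex_of_real r"
    and conj: "\<And>x. h (conjugate x) = cnj (h x)" and norm: "\<And>x. norm (h x) = norm x"
    and le: "\<And>x y. x \<le> y \<longleftrightarrow> h x \<le> h y"
    using real_or_complex[where ?'a = 'a] by blast
  have real: "h (of_real r) = complex_of_real r" for r
    using scale[of r] by (simp add: of_real_def)
  have inj: "a = b" if "h a = h b" for a b
  proof -
    have "h a = h (a - b) + h b" using add[of "a - b" b] by simp
    hence "norm (a - b) = 0" using that norm[of "a - b"] by simp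
    thus ?thesis by simp
  qed
  have zero: "h 0 = 0" using real[of 0] by simp
  show "x * conjugate x = of_real ((norm x)\<^sup>2)"
    by (rule inj) (simp only: mult conj real complex_norm_square flip: norm)
  show "norm (conjugate x) = norm x" by (metis norm conj complex_mod_cnj)
  show "conjugate (of_real r :: 'a) = of_real r" by (rule inj) (simp add: conj real)
  show "norm x \<le> norm y" if "0 \<le> x" "x \<le> y"
  proof -
    \<comment> \<open>Comparable complex numbers have equal imaginary parts, so above 0 the order is
      that of the non-negative reals and agrees with the order of moduli.\<close>
    have "0 \<le> h x" "h x \<le> h y" using that le zero by metis+
    thus ?thesis unfolding norm[symmetric] by (simp add: less_eq_complex_def cmod_def)
  qed
qed

end

lemma conjugate_minus: "conjugate (x - y :: 'a::conjugatable_ring) = conjugate x - conjugate y"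
  using conjugate_dist_add[of x "- y"] by (simp add: conjugate_neg)


section \<open>Finite orthonormal systems of functions\<close>

text \<open>The index set is arbitrary because coordinates will be pairs (row, slice): a column
  spread over several slices then counts as one vector.\<close>

definition cdot :: "'a set \<Rightarrow> ('a \<Rightarrow> 'f::real_or_complex) \<Rightarrow> ('a \<Rightarrow> 'f) \<Rightarrow> 'f" where
  "cdot A x y = (\<Sum>a\<in>A. x a * conjugate (y a))"

text \<open>A family rather than a set, so that it covers both singular vectors indexed by
  \<open>n\<close> and a set \<open>W\<close> of functions indexed by itself through
  \<open>\<lambda>w. w\<close>.\<close>

definition orthonormal_on :: "'a set \<Rightarrow> 'j set \<Rightarrow> ('j \<Rightarrow> 'a \<Rightarrow> 'f::real_or_complex) \<Rightarrow> bool" where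
  "orthonormal_on A J w \<longleftrightarrow> (\<forall>i\<in>J. \<forall>j\<in>J. cdot A (w i) (w j) = (if i = j then 1 else 0))"

lemma cdot_self: "cdot A x x = of_real (\<Sum>a\<in>A. (norm (x a))\<^sup>2)"
  by (simp add: cdot_def mult_conjugate_self)

lemma cdot_commute: "cdot A y x = conjugate (cdot A x y)"
proof (cases "finite A")
  case True
  thus ?thesis by (simp add: cdot_def sum_conjugate conjugate_dist_mul mult.commute)
qed (simp add: cdot_def)

lemma cdot_diff_left: "cdot A (\<lambda>a. x a - y a) z = cdot A x z - cdot A y z"
  by (simp add: cdot_def left_diff_distrib sum_subtractf)

lemma cdot_diff_right: "cdot A z (\<lambda>a. x a - y a) = cdot A z x - cdot A z y"
  by (simp add: cdot_def right_diff_distrib sum_subtractf conjugate_minus)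

lemma cdot_scale_left: "cdot A (\<lambda>a. c * x a) y = c * cdot A x y"
  by (simp add: cdot_def sum_distrib_left mult.assoc)

lemma cdot_scale_right: "cdot A x (\<lambda>a. c * y a) = conjugate c * cdot A x y"
  by (simp add: cdot_def sum_distrib_left conjugate_dist_mul mult_ac)

lemma cdot_sum_left: "cdot A (\<lambda>a. \<Sum>j\<in>J. c j * x j a) y = (\<Sum>j\<in>J. c j * cdot A (x j) y)"
  unfolding cdot_def sum_distrib_right sum_distrib_left
  by (subst sum.swap) (simp add: mult.assoc)

lemma cdot_add_left: "cdot A (\<lambda>a. x a + y a) z = cdot A x z + cdot A y z"
  by (simp add: cdot_def distrib_right sum.distrib)

lemma cdot_residual_orthogonal:
  assumes "finite J" "orthonormal_on A J w" "i \<in> J"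
  shows "cdot A (\<lambda>a. x a - (\<Sum>j\<in>J. cdot A x (w j) * w j a)) (w i) = 0"
proof -
  have "(\<Sum>j\<in>J. cdot A x (w j) * cdot A (w j) (w i)) = (\<Sum>j\<in>J. if j = i then cdot A x (w i) else 0)"
    using assms by (intro sum.cong) (auto simp: orthonormal_on_def)
  thus ?thesis using assms by (simp add: cdot_diff_left cdot_sum_left)
qed

text \<open>Pythagoras: the residual \<open>r\<close> is orthogonal to the projection, so
  \<open>cdot A r r\<close> collapses to \<open>cdot A r x\<close>, whose expansion produces the
  squared coefficients.\<close>

lemma bessel_identity:
  fixes x :: "'a \<Rightarrow> 'f::real_or_complex"
  assumes J: "finite J" and on: "orthonormal_on A J w"
  shows "(\<Sum>a\<in>A. (norm (x a - (\<Sum>j\<in>J. cdot A x (w j) * w j a)))\<^sup>2) =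
    (\<Sum>a\<in>A. (norm (x a))\<^sup>2) - (\<Sum>j\<in>J. (norm (cdot A x (w j)))\<^sup>2)"
proof -
  define c where "c j = cdot A x (w j)" for j
  define r where "r a = x a - (\<Sum>j\<in>J. c j * w j a)" for a
  have orth: "cdot A r (w i) = 0" if "i \<in> J" for i
    using cdot_residual_orthogonal[OF J on that, of x] by (simp add: r_def[abs_def] c_def)
  have "cdot A (\<lambda>a. \<Sum>j\<in>J. c j * w j a) r = (\<Sum>j\<in>J. c j * cdot A (w j) r)"
    by (rule cdot_sum_left)
  also have "\<dots> = 0"
    by (rule sum.neutral) (metis orth cdot_commute conjugate_zero mult_zero_right)
  finally have z: "cdot A (\<lambda>a. \<Sum>j\<in>J. c j * w j a) r = 0" .
  have "cdot A r r = cdot A r (\<lambda>a. x a - (\<Sum>j\<in>J. c j * w j a))"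
    by (simp add: r_def[abs_def])
  also have "\<dots> = cdot A r x"
    using cdot_commute[of A r "\<lambda>a. \<Sum>j\<in>J. c j * w j a"] z by (simp add: cdot_diff_right)
  also have "\<dots> = cdot A x x - (\<Sum>j\<in>J. c j * cdot A (w j) x)"
    unfolding r_def by (simp add: cdot_diff_left cdot_sum_left)
  also have "(\<Sum>j\<in>J. c j * cdot A (w j) x) = of_real (\<Sum>j\<in>J. (norm (c j))\<^sup>2)"
    unfolding of_real_sum
    by (rule sum.cong[OF refl]) (metis c_def cdot_commute mult_conjugate_self)
  finally have "(of_real (\<Sum>a\<in>A. (norm (r a))\<^sup>2) :: 'f) =
      of_real ((\<Sum>a\<in>A. (norm (x a))\<^sup>2) - (\<Sum>j\<in>J. (norm (c j))\<^sup>2))"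
    by (simp add: cdot_self)
  thus ?thesis unfolding of_real_eq_iff by (simp add: r_def c_def)
qed

lemma bessel_inequality:
  assumes "finite J" "orthonormal_on A J w"
  shows "(\<Sum>j\<in>J. (norm (cdot A x (w j)))\<^sup>2) \<le> (\<Sum>a\<in>A. (norm (x a))\<^sup>2)"
proof -
  have "0 \<le> (\<Sum>a\<in>A. (norm (x a - (\<Sum>j\<in>J. cdot A x (w j) * w j a)))\<^sup>2)"
    by (simp add: sum_nonneg)
  thus ?thesis unfolding bessel_identity[OF assms] by simp
qed

text \<open>Subtracting a vector of the span does not change the residual, so \<open>x\<close> and
  \<open>x - y\<close> share it, and a residual is never longer than its vector.\<close>

lemma distance_to_span_ge:
  assumes J: "finite J" and on: "orthonormal_on A J w"
    and y: "\<And>a. a \<in> A \<Longrightarrow> y a = (\<Sum>j\<in>J. cdot A y (w j) * w j a)"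
  shows "(\<Sum>a\<in>A. (norm (x a))\<^sup>2) - (\<Sum>j\<in>J. (norm (cdot A x (w j)))\<^sup>2) \<le>
    (\<Sum>a\<in>A. (norm (x a - y a))\<^sup>2)"
proof -
  have "(\<Sum>a\<in>A. (norm (x a))\<^sup>2) - (\<Sum>j\<in>J. (norm (cdot A x (w j)))\<^sup>2) =
      (\<Sum>a\<in>A. (norm (x a - (\<Sum>j\<in>J. cdot A x (w j) * w j a)))\<^sup>2)"
    by (rule bessel_identity[OF J on, symmetric])
  also have "\<dots> = (\<Sum>a\<in>A. (norm ((x a - y a) -
      (\<Sum>j\<in>J. cdot A (\<lambda>a. x a - y a) (w j) * w j a)))\<^sup>2)"
  proof (rule sum.cong[OF refl])
    fix a assume "a \<in> A"
    hence "x a - (\<Sum>j\<in>J. cdot A x (w j) * w j a) =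
      (x a - y a) - (\<Sum>j\<in>J. cdot A (\<lambda>a. x a - y a) (w j) * w j a)"
      using y[of a] by (simp add: cdot_diff_left left_diff_distrib sum_subtractf)
    thus "(norm (x a - (\<Sum>j\<in>J. cdot A x (w j) * w j a)))\<^sup>2 = (norm ((x a - y a) -
      (\<Sum>j\<in>J. cdot A (\<lambda>a. x a - y a) (w j) * w j a)))\<^sup>2" by (simp only:)
  qed
  also have "\<dots> \<le> (\<Sum>a\<in>A. (norm (x a - y a))\<^sup>2)"
    unfolding bessel_identity[OF J on] by (simp add: sum_nonneg)
  finally show ?thesis .
qed

text \<open>Expansions are claimed only on \<open>A\<close>, since \<open>cdot\<close> does not see
  values elsewhere. A generator with zero residual adds no vector, whence an upper bound on the size
  of \<open>W\<close>.\<close>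

lemma gram_schmidt_functions:
  fixes B :: "('a \<Rightarrow> 'f::real_or_complex) set"
  assumes A: "finite A" and "finite B"
  obtains W where "finite W" "card W \<le> card B" "orthonormal_on A W (\<lambda>w. w)"
    "\<And>b a. b \<in> B \<Longrightarrow> a \<in> A \<Longrightarrow> b a = (\<Sum>w\<in>W. cdot A b w * w a)"
proof -
  have "\<exists>W. finite W \<and> card W \<le> card B \<and> orthonormal_on A W (\<lambda>w. w) \<and>
      (\<forall>b\<in>B. \<forall>a\<in>A. b a = (\<Sum>w\<in>W. cdot A b w * w a))"
    using \<open>finite B\<close>
  proof induction
    case empty
    thus ?case by (intro exI[of _ "{}"]) (simp add: orthonormal_on_def)
  next
    case (insert b B)
    then obtain W where W: "finite W" "card W \<le> card B" "orthonormal_on A W (\<lambda>w. w)"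
      "\<forall>b\<in>B. \<forall>a\<in>A. b a = (\<Sum>w\<in>W. cdot A b w * w a)"
      by blast
    define r where "r a = b a - (\<Sum>w\<in>W. cdot A b w * w a)" for a
    define N where "N = sqrt (\<Sum>a\<in>A. (norm (r a))\<^sup>2)"
    have N2: "N\<^sup>2 = (\<Sum>a\<in>A. (norm (r a))\<^sup>2)"
      by (simp add: N_def sum_nonneg)
    show ?case
    proof (cases "N = 0")
      case True
      hence "\<forall>a\<in>A. r a = 0"
        using N2 A by (simp add: sum_nonneg_eq_0_iff)
      hence "\<forall>a\<in>A. b a = (\<Sum>w\<in>W. cdot A b w * w a)" by (simp add: r_def)
      thus ?thesis using W insert.hyps by (intro exI[of _ W]) auto
    next
      case False
      define v where "v a = of_real (inverse N) * r a" for a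
      have rw: "cdot A r w = 0" if "w \<in> W" for w
        using cdot_residual_orthogonal[OF W(1,3) that, of b] by (simp add: r_def[abs_def])
      have vw: "cdot A v w = 0" if "w \<in> W" for w
        using rw[OF that] unfolding v_def cdot_scale_left by simp
      have wv: "cdot A w v = 0" if "w \<in> W" for w
        using vw[OF that] cdot_commute[of A w v] by simp
      have rr: "cdot A r r = of_real (N\<^sup>2)" by (simp add: cdot_self N2)
      have rv: "cdot A r v = of_real N"
        unfolding v_def cdot_scale_right rr conjugate_of_real of_real_mult[symmetric]
        using False by (simp add: power2_eq_square)
      have vv: "cdot A v v = 1"
        using cdot_scale_left[of A "of_real (inverse N)" r v, folded v_def] rv False by simp
      \<comment> \<open>\<open>v\<close> is orthogonal to every element of \<open>W\<close> but not
        to itself. This is what lets sums over \<open>insert v W\<close> split.\<close>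
      have vW: "v \<notin> W" using vw vv by fastforce
      have on: "orthonormal_on A (insert v W) (\<lambda>w. w)"
        using W(3) vv vw wv vW unfolding orthonormal_on_def by auto
      have b: "b a = r a + (\<Sum>w\<in>W. cdot A b w * w a)" for a by (simp add: r_def)
      have "cdot A (\<lambda>a. \<Sum>w\<in>W. cdot A b w * w a) v = 0"
        unfolding cdot_sum_left using wv by simp
      hence bv: "cdot A b v = of_real N"
        using cdot_add_left[of A r "\<lambda>a. \<Sum>w\<in>W. cdot A b w * w a" v] rv
        by (simp add: b[abs_def, symmetric])
      have "b a = cdot A b v * v a + (\<Sum>w\<in>W. cdot A b w * w a)" for a
        unfolding bv using b[of a] False by (simp add: v_def)
      \<comment> \<open>Earlier generators already lie in the span of \<open>W\<close>, so their
        coefficient along the new vector is 0 and their expansion survives.\<close>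
      moreover have "x a = cdot A x v * v a + (\<Sum>w\<in>W. cdot A x w * w a)"
        if "x \<in> B" "a \<in> A" for x a
      proof -
        have x: "x a = (\<Sum>w\<in>W. cdot A x w * w a)" if "a \<in> A" for a
          using W(4) that \<open>x \<in> B\<close> by blast
        have "cdot A x v = cdot A (\<lambda>a. \<Sum>w\<in>W. cdot A x w * w a) v"
          unfolding cdot_def[of A _ v] using x by simp
        also have "\<dots> = 0" unfolding cdot_sum_left using wv by simp
        finally show ?thesis using x[OF \<open>a \<in> A\<close>] by simp
      qed
      ultimately show ?thesis using W insert.hyps on vW
        by (intro exI[of _ "insert v W"]) auto
    qed
  qed
  thus ?thesis using that by blast
qed

text \<open>Everything is compared with the threshold \<open>s q\<close>. Weight placed beyond
  \<open>q\<close> gains at most \<open>s q\<close> per unit, weight missing up to \<open>q\<close>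
  loses at least \<open>s q\<close> per unit, and a total of at most \<open>q\<close> means that no
  more is placed beyond than is missing before.\<close>

lemma sum_tail_le_weighted:
  fixes s c :: "nat \<Rightarrow> real"
  assumes mono: "\<And>n k. 1 \<le> n \<Longrightarrow> n \<le> k \<Longrightarrow> s k \<le> s n" and s: "\<And>n. 1 \<le> n \<Longrightarrow> 0 \<le> s n"
    and c: "\<And>n. 0 \<le> c n" "\<And>n. n \<in> {1..N} \<Longrightarrow> c n \<le> 1"
    and q: "1 \<le> q" and sum: "(\<Sum>n=1..N. c n) \<le> real q"
  shows "(\<Sum>n=1..N. s n) - (\<Sum>n=1..q. s n) \<le> (\<Sum>n=1..N. s n * (1 - c n))"
proof (cases "q \<le> N")
  case True
  have "s q * c n \<ge> s n * c n" if "n \<in> {q<..N}" for n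
    using that mono[of q n] c q by (intro mult_right_mono) auto
  moreover have "s q * (1 - c n) \<le> s n * (1 - c n)" if "n \<in> {1..q}" for n
    using that mono[of n q] c True by (intro mult_right_mono) auto
  ultimately have 1: "(\<Sum>n\<in>{q<..N}. s n * c n) \<le> (\<Sum>n\<in>{q<..N}. s q * c n)"
    and 2: "(\<Sum>n=1..q. s q * (1 - c n)) \<le> (\<Sum>n=1..q. s n * (1 - c n))"
    by (auto intro!: sum_mono)
  have split: "(\<Sum>n=1..N. f n) = (\<Sum>n=1..q. f n) + (\<Sum>n\<in>{q<..N}. f n)" for f :: "nat \<Rightarrow> real"
  proof -
    have "{1..N} = {1..q} \<union> {q<..N}" using True q by auto
    thus ?thesis by (simp add: sum.union_disjoint ivl_disj_int)
  qed
  have "s q * (\<Sum>n=1..N. c n) \<le> s q * real q"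
    using sum s[OF q] by (rule mult_left_mono)
  moreover have "(\<Sum>n=1..q. s q * (1 - c n)) = s q * real q - s q * (\<Sum>n=1..q. c n)"
    by (simp add: right_diff_distrib sum_subtractf sum_distrib_left)
  moreover have "s q * (\<Sum>n=1..N. c n) = s q * (\<Sum>n=1..q. c n) + (\<Sum>n\<in>{q<..N}. s q * c n)"
    unfolding split by (simp add: distrib_left sum_distrib_left)
  ultimately have "(\<Sum>n\<in>{q<..N}. s n * c n) \<le> (\<Sum>n=1..q. s n * (1 - c n))"
    using 1 2 by linarith
  thus ?thesis unfolding split by (simp add: right_diff_distrib sum_subtractf)
next
  case False
  \<comment> \<open>Here \<open>N < q\<close>: the left-hand side is non-positive and the right-hand
    side non-negative.\<close>
  have "(\<Sum>n=1..N. s n) \<le> (\<Sum>n=1..q. s n)"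
    using False s by (intro sum_mono2) auto
  moreover have "0 \<le> (\<Sum>n=1..N. s n * (1 - c n))"
    using s c by (intro sum_nonneg mult_nonneg_nonneg) auto
  ultimately show ?thesis by linarith
qed


section \<open>Hilbert spaces with an orthonormal basis\<close>

text \<open>Cauchy criterion for unordered sums: sums over sets avoiding \<open>F0\<close> are
  small, so the net of finite partial sums is a Cauchy filter, and completeness gives its
  limit.\<close>

lemma summable_on_banachI:
  fixes f :: "'a \<Rightarrow> 'b::banach"
  assumes "\<And>e. e > 0 \<Longrightarrow> \<exists>F0. finite F0 \<and> (\<forall>F. finite F \<and> F \<inter> F0 = {} \<longrightarrow> norm (sum f F) < e)"
  shows "f summable_on UNIV"
proof -
  let ?G = "filtermap (sum f) (finite_subsets_at_top UNIV)"
  have "cauchy_filter ?G"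
    unfolding cauchy_filter_def
  proof (rule filter_leI)
    fix E :: "'b \<times> 'b \<Rightarrow> bool" assume "eventually E uniformity"
    then obtain e where e: "e > 0" "\<And>x y. dist x y < e \<Longrightarrow> E (x, y)"
      by (auto simp: eventually_uniformity_metric)
    obtain F0 where F0: "finite F0" "\<And>F. finite F \<Longrightarrow> F \<inter> F0 = {} \<Longrightarrow> norm (sum f F) < e / 2"
      using assms[of "e / 2"] e by auto
    define P where "P x \<longleftrightarrow> norm (x - sum f F0) < e / 2" for x
    have "norm (sum f F - sum f F0) < e / 2" if "finite F" "F0 \<subseteq> F" for F
    proof -
      have "(F - F0) \<inter> F0 = {}" by blast
      thus ?thesis using F0(2)[of "F - F0"] that by (simp add: sum_diff)
    qed
    hence "eventually (\<lambda>F. P (sum f F)) (finite_subsets_at_top UNIV)"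
      unfolding eventually_finite_subsets_at_top P_def using F0(1) by blast
    hence "eventually P ?G" by (simp add: eventually_filtermap)
    moreover have "E (x, y)" if "P x" "P y" for x y
    proof (rule e(2))
      have "x - y = (x - sum f F0) - (y - sum f F0)" by simp
      hence "norm (x - y) \<le> norm (x - sum f F0) + norm (y - sum f F0)"
        by (metis norm_triangle_ineq4)
      thus "dist x y < e" using that by (simp add: P_def dist_norm)
    qed
    ultimately show "eventually E (?G \<times>\<^sub>F ?G)"
      unfolding eventually_prod_filter by (intro exI[of _ P]) blast
  qed
  moreover have "complete (UNIV :: 'b set)"
    by (meson Cauchy_convergent UNIV_I complete_def convergent_def)
  ultimately obtain x where "?G \<le> nhds x"
    using cauchy_filter_complete_converges[of ?G UNIV]
    by (auto simp: filtermap_bot_iff)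
  hence "(sum f \<longlongrightarrow> x) (finite_subsets_at_top UNIV)"
    by (simp add: filterlim_def)
  thus ?thesis
    unfolding summable_on_def has_sum_def by blast
qed

locale based_hilbert =
  fixes H :: "('f::real_or_complex, 'h::banach) based_space"
  assumes based: "based_hilbert_space H"
begin

sublocale hs: vector_space "smul H"
  using based by (simp add: based_hilbert_space_def)

lemmas based_conjuncts = based[unfolded based_hilbert_space_def, THEN conjunct2]

lemma smul_of_real: "smul H (of_real r) x = r *\<^sub>R x"
  using based_conjuncts[THEN conjunct1] by blast

lemma ip_add_left: "ip H (x + y) z = ip H x z + ip H y z"
  using based_conjuncts[THEN conjunct2, THEN conjunct1] by blast

lemma ip_smul_left: "ip H (smul H c x) y = c * ip H x y"
  using based_conjuncts[THEN conjunct2, THEN conjunct2, THEN conjunct1] by blast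

lemma ip_commute: "ip H y x = conjugate (ip H x y)"
  using based_conjuncts[THEN conjunct2, THEN conjunct2, THEN conjunct2, THEN conjunct1] by blast

lemma ip_self: "ip H x x = of_real ((norm x)\<^sup>2)"
  using based_conjuncts[THEN conjunct2, THEN conjunct2, THEN conjunct2, THEN conjunct2, THEN conjunct1] by blast

lemma ip_bas: "ip H (bas H i) (bas H j) = (if i = j then 1 else 0)"
  using based_conjuncts[THEN conjunct2, THEN conjunct2, THEN conjunct2, THEN conjunct2, THEN conjunct2, THEN conjunct1] by blast

lemma closure_span_bas: "closure (hs.span (range (bas H))) = UNIV"
  using based_conjuncts[THEN conjunct2, THEN conjunct2, THEN conjunct2, THEN conjunct2, THEN conjunct2, THEN conjunct2] .

lemma ip_diff_left: "ip H (x - y) z = ip H x z - ip H y z"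
  using ip_add_left[of "x - y" y z] by simp

lemma ip_zero_left [simp]: "ip H 0 z = 0"
  using ip_diff_left[of z z z] by simp

lemma ip_add_right: "ip H z (x + y) = ip H z x + ip H z y"
  by (metis ip_commute ip_add_left conjugate_dist_add)

lemma ip_diff_right: "ip H z (x - y) = ip H z x - ip H z y"
  using ip_add_right[of z "x - y" y] by simp

lemma ip_smul_right: "ip H z (smul H c x) = conjugate c * ip H z x"
  by (metis ip_commute ip_smul_left conjugate_dist_mul)

lemma ip_zero_right [simp]: "ip H z 0 = 0"
  using ip_diff_right[of z z z] by simp

lemma norm_bas [simp]: "norm (bas H j) = 1"
proof -
  have "(of_real ((norm (bas H j))\<^sup>2) :: 'f) = of_real 1"
    using ip_self[of "bas H j"] ip_bas[of j j] by simp
  hence "(norm (bas H j))\<^sup>2 = 1\<^sup>2" unfolding of_real_eq_iff by simp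
  thus ?thesis by (subst (asm) power2_eq_iff_nonneg) auto
qed

lemma ip_sum_left: "ip H (sum f F) z = (\<Sum>a\<in>F. ip H (f a) z)"
  by (induction F rule: infinite_finite_induct) (simp_all add: ip_add_left)

lemma ip_sum_right: "ip H z (sum f F) = (\<Sum>a\<in>F. ip H z (f a))"
  by (induction F rule: infinite_finite_induct) (simp_all add: ip_add_right)

lemma norm_diff_squared_orthogonal:
  assumes "ip H x y = 0"
  shows "(norm (x - y))\<^sup>2 = (norm x)\<^sup>2 + (norm y)\<^sup>2"
proof -
  have "ip H y x = 0" using assms ip_commute[of y x] by simp
  hence "ip H (x - y) (x - y) = ip H x x + ip H y y"
    using assms by (simp add: ip_diff_left ip_diff_right)
  hence "(of_real ((norm (x - y))\<^sup>2) :: 'f) = of_real ((norm x)\<^sup>2 + (norm y)\<^sup>2)"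
    by (simp only: ip_self of_real_add)
  thus ?thesis by (simp only: of_real_eq_iff)
qed

lemma coef_add [simp]: "coef H (x + y) j = coef H x j + coef H y j"
  and coef_diff [simp]: "coef H (x - y) j = coef H x j - coef H y j"
  and coef_zero [simp]: "coef H 0 j = 0"
  and coef_smul [simp]: "coef H (smul H c x) j = c * coef H x j"
  and coef_bas: "coef H (bas H i) j = (if i = j then 1 else 0)"
  and coef_sum [simp]: "coef H (sum f F) j = (\<Sum>a\<in>F. coef H (f a) j)"
  by (simp_all add: coef_def ip_add_left ip_diff_left ip_smul_left ip_bas ip_sum_left)

lemma ip_sum_bas_right:
  "ip H z (\<Sum>j\<in>F. smul H (c j) (bas H j)) = (\<Sum>j\<in>F. conjugate (c j) * coef H z j)"
  by (simp add: ip_sum_right ip_smul_right coef_def)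

lemma norm_sum_bas:
  assumes "finite F"
  shows "(norm (\<Sum>j\<in>F. smul H (c j) (bas H j)))\<^sup>2 = (\<Sum>j\<in>F. (norm (c j))\<^sup>2)"
proof -
  let ?x = "\<Sum>j\<in>F. smul H (c j) (bas H j)"
  have "ip H ?x ?x = (\<Sum>j\<in>F. conjugate (c j) * coef H ?x j)"
    by (rule ip_sum_bas_right)
  also have "\<dots> = (\<Sum>j\<in>F. of_real ((norm (c j))\<^sup>2))"
  proof (rule sum.cong[OF refl])
    fix j assume "j \<in> F"
    hence "coef H ?x j = c j" using assms by (simp add: coef_bas if_distrib cong: if_cong)
    thus "conjugate (c j) * coef H ?x j = of_real ((norm (c j))\<^sup>2)"
      by (simp only: mult.commute[of "conjugate (c j)"] mult_conjugate_self)
  qed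
  finally show ?thesis by (simp only: ip_self of_real_eq_iff flip: of_real_sum)
qed

lemma sum_norm_coef_le:
  assumes F: "finite F"
  shows "(\<Sum>j\<in>F. (norm (coef H x j))\<^sup>2) \<le> (norm x)\<^sup>2"
proof -
  let ?y = "\<Sum>j\<in>F. smul H (coef H x j) (bas H j)"
  have "coef H (x - ?y) j = 0" if "j \<in> F" for j
    using F that by (simp add: coef_bas if_distrib cong: if_cong)
  hence "ip H (x - ?y) ?y = 0"
    unfolding ip_sum_right ip_smul_right by (simp add: coef_def)
  \<comment> \<open>The sign turns the Pythagoras rule for differences into a decomposition of
    \<open>x\<close> as \<open>(x - ?y) - (- ?y)\<close>.\<close>
  hence "ip H (x - ?y) (- ?y) = 0"
    using ip_diff_right[of "x - ?y" 0 ?y] by simp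
  from norm_diff_squared_orthogonal[OF this]
  have "(norm ?y)\<^sup>2 \<le> (norm x)\<^sup>2" by simp
  thus ?thesis by (simp add: norm_sum_bas[OF F])
qed

lemma norm_coef_le: "norm (coef H x j) \<le> norm x"
  using sum_norm_coef_le[of "{j}" x] by simp

text \<open>The difference is orthogonal to the span of the basis, so no vector of the span is
  nearer to it than 0 is; density of the span then forces its norm to be 0.\<close>

lemma coef_eqI:
  assumes "\<And>j. coef H x j = coef H y j"
  shows "x = y"
proof -
  let ?d = "x - y"
  have orth: "hs.span (range (bas H)) \<subseteq> {z. ip H ?d z = 0}"
  proof (rule hs.span_minimal)
    show "range (bas H) \<subseteq> {z. ip H ?d z = 0}"
      using assms by (auto simp: coef_def ip_diff_left)
    show "hs.subspace {z. ip H ?d z = 0}"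
      by (auto intro!: hs.subspaceI simp: ip_add_right ip_smul_right)
  qed
  have far: "norm ?d \<le> norm (?d - z)" if "z \<in> hs.span (range (bas H))" for z
  proof -
    have "ip H ?d z = 0" using that orth by blast
    hence "(norm (?d - z))\<^sup>2 = (norm ?d)\<^sup>2 + (norm z)\<^sup>2" by (rule norm_diff_squared_orthogonal)
    hence "(norm ?d)\<^sup>2 \<le> (norm (?d - z))\<^sup>2" by (simp only: le_add_same_cancel1 zero_le_power2)
    thus ?thesis by (rule power2_le_imp_le) (rule norm_ge_zero)
  qed
  have "norm ?d = 0"
  proof (rule ccontr)
    assume "norm ?d \<noteq> 0"
    hence "0 < norm ?d" by (simp only: zero_less_norm_iff norm_eq_zero not_False_eq_True)
    moreover have "?d \<in> closure (hs.span (range (bas H)))" by (simp add: closure_span_bas)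
    ultimately obtain z where "z \<in> hs.span (range (bas H))" "dist z ?d < norm ?d"
      using closure_approachable by blast
    thus False using far[of z] by (simp add: dist_norm norm_minus_commute)
  qed
  thus ?thesis by simp
qed

lemma bounded_linear_coef: "bounded_linear (\<lambda>x. coef H x j)"
proof (rule bounded_linear_intro)
  show "coef H (r *\<^sub>R x) j = r *\<^sub>R coef H x j" for r x
    by (simp add: scaleR_conv_of_real flip: smul_of_real)
  show "norm (coef H x j) \<le> norm x * 1" for x
    using norm_coef_le by simp
qed simp

section \<open>Square-summable sequences and the vectors they represent\<close>

definition square_summable :: "(int \<Rightarrow> 'f) \<Rightarrow> bool" where
  "square_summable c \<longleftrightarrow> (\<lambda>j. (norm (c j))\<^sup>2) summable_on UNIV"

definition series :: "(int \<Rightarrow> 'f) \<Rightarrow> 'h" where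
  "series c = (\<Sum>\<^sub>\<infinity>j\<in>UNIV. smul H (c j) (bas H j))"

text \<open>Riesz-Fischer: by \<open>norm_sum_bas\<close> the squared norm of a finite block of the
  series is the same block of the scalar series, which passes on the Cauchy criterion.\<close>

lemma series_has_sum:
  assumes "square_summable c"
  shows "((\<lambda>j. smul H (c j) (bas H j)) has_sum series c) UNIV"
  unfolding series_def
proof (rule has_sum_infsum, rule summable_on_banachI)
  fix e :: real assume e: "e > 0"
  let ?g = "\<lambda>j. (norm (c j))\<^sup>2"
  have g: "?g summable_on UNIV" using assms by (simp add: square_summable_def)
  \<comment> \<open>The tail is controlled through squared norms, hence \<open>e\<^sup>2\<close>;
    the factor 1/2 turns the non-strict approximation into a strict bound.\<close>
  obtain F0 where F0: "finite F0" "dist (sum ?g F0) (infsum ?g UNIV) \<le> e\<^sup>2 / 2"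
    using infsum_finite_approximation[OF g, of "e\<^sup>2 / 2"] e by auto
  show "\<exists>F0. finite F0 \<and> (\<forall>F. finite F \<and> F \<inter> F0 = {} \<longrightarrow>
      norm (\<Sum>j\<in>F. smul H (c j) (bas H j)) < e)"
  proof (intro exI[of _ F0] conjI allI impI F0(1))
    fix F assume F: "finite F \<and> F \<inter> F0 = {}"
    have "sum ?g F + sum ?g F0 = sum ?g (F \<union> F0)"
      using F F0(1) by (simp add: sum.union_disjoint)
    also have "\<dots> \<le> infsum ?g UNIV"
      using F F0(1) by (intro finite_sum_le_infsum[OF g]) auto
    finally have "sum ?g F \<le> e\<^sup>2 / 2" using F0(2) unfolding dist_real_def by linarith
    also have "\<dots> < e\<^sup>2" using e by simp
    finally have "(norm (\<Sum>j\<in>F. smul H (c j) (bas H j)))\<^sup>2 < e\<^sup>2"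
      using F by (simp add: norm_sum_bas)
    thus "norm (\<Sum>j\<in>F. smul H (c j) (bas H j)) < e"
      using e by (intro power2_less_imp_less[of _ e]) auto
  qed
qed

lemma coef_series:
  assumes "square_summable c"
  shows "coef H (series c) k = c k"
proof -
  have "((\<lambda>j. coef H (smul H (c j) (bas H j)) k) has_sum coef H (series c) k) UNIV"
    using has_sum_bounded_linear[OF bounded_linear_coef series_has_sum[OF assms]] .
  moreover have "((\<lambda>j. coef H (smul H (c j) (bas H j)) k) has_sum c k) UNIV"
    by (rule has_sum_finite_neutralI[where B = "{k}"]) (auto simp: coef_bas)
  ultimately show ?thesis by (rule has_sum_unique)
qed

lemma square_summable_coef: "square_summable (coef H x)"
  unfolding square_summable_def
  by (rule nonneg_bdd_above_summable_on)
    (auto intro!: bdd_aboveI[of _ "(norm x)\<^sup>2"] sum_norm_coef_le)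

lemma series_coef: "series (coef H x) = x"
  by (rule coef_eqI) (simp add: coef_series square_summable_coef)

lemma parseval: "((\<lambda>j. (norm (coef H x j))\<^sup>2) has_sum (norm x)\<^sup>2) UNIV"
proof -
  have "(sum (\<lambda>j. smul H (coef H x j) (bas H j)) \<longlongrightarrow> x) (finite_subsets_at_top UNIV)"
    using series_has_sum[OF square_summable_coef[of x]] by (simp add: series_coef has_sum_def)
  hence "((\<lambda>F. (norm (\<Sum>j\<in>F. smul H (coef H x j) (bas H j)))\<^sup>2) \<longlongrightarrow> (norm x)\<^sup>2)
      (finite_subsets_at_top UNIV)"
    by (intro tendsto_intros)
  thus ?thesis
    unfolding has_sum_def
    by (rule Lim_transform_eventually)
      (auto intro!: eventually_finite_subsets_at_top_weakI simp: norm_sum_bas)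
qed

lemma square_summable_mult:
  assumes "bounded (range c)" "square_summable d"
  shows "square_summable (\<lambda>j. c j * d j)"
proof -
  obtain K where K: "\<And>j. norm (c j) \<le> K" using assms(1) by (auto simp: bounded_iff)
  have "(\<lambda>j. K\<^sup>2 * (norm (d j))\<^sup>2) summable_on UNIV"
    using assms(2) by (auto intro: summable_on_cmult_right simp: square_summable_def)
  thus ?thesis unfolding square_summable_def
    by (rule summable_on_comparison_test)
      (auto simp: norm_mult power_mult_distrib intro!: mult_right_mono power_mono K)
qed

lemma bounded_coef: "bounded (range (coef H x))"
  using norm_coef_le by (auto simp: bounded_iff)


section \<open>Quasitubes as bounded sequences\<close>

text \<open>The multiplication operator with symbol \<open>c\<close> in the fixed basis, the inverse
  of \<open>tube_coef\<close> on bounded sequences. For unbounded \<open>c\<close> the series may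
  diverge.\<close>

definition diag :: "(int \<Rightarrow> 'f) \<Rightarrow> 'h \<Rightarrow> 'h" where
  "diag c x = series (\<lambda>j. c j * coef H x j)"

lemma coef_diag: "bounded (range c) \<Longrightarrow> coef H (diag c x) j = c j * coef H x j"
  unfolding diag_def by (rule coef_series) (rule square_summable_mult[OF _ square_summable_coef])

lemma star_eq_diag: "star H x = diag (coef H x)"
  by (simp add: fun_eq_iff star_def diag_def series_def)

lemma coef_star [simp]: "coef H (star H x y) j = coef H x j * coef H y j"
  by (simp add: star_eq_diag coef_diag bounded_coef)

lemma diag_in_quasitubes:
  assumes c: "bounded (range c)"
  shows "diag c \<in> quasitubes H"
proof -
  obtain K where K: "\<And>j. norm (c j) \<le> K" using c by (auto simp: bounded_iff)
  have K0: "0 \<le> K" using K[of 0] norm_ge_zero order_trans by blast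
  have "norm (diag c x) \<le> K * norm x" for x
  proof (rule power2_le_imp_le)
    have "((\<lambda>j. K\<^sup>2 * (norm (coef H x j))\<^sup>2) has_sum K\<^sup>2 * (norm x)\<^sup>2) UNIV"
      by (intro has_sum_cmult_right parseval)
    from has_sum_mono[OF parseval[of "diag c x"] this]
    show "(norm (diag c x))\<^sup>2 \<le> (K * norm x)\<^sup>2"
      by (simp add: coef_diag[OF c] norm_mult power_mult_distrib mult_right_mono power_mono K)
  qed (use K0 in simp)
  moreover have "diag c (star H a x + star H b y) = star H a (diag c x) + star H b (diag c y)"
    for a b x y
    by (rule coef_eqI) (simp add: coef_diag[OF c] algebra_simps)
  ultimately show ?thesis unfolding quasitubes_def by blast
qed

lemma tube_coef_diag [simp]: "bounded (range c) \<Longrightarrow> tube_coef H (diag c) = c"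
  using coef_diag[of c "bas H j" j for j] by (simp add: fun_eq_iff tube_coef_def coef_bas flip: coef_def)

lemma star_in_quasitubes [simp]: "star H x \<in> quasitubes H"
  and tube_coef_star [simp]: "tube_coef H (star H x) = coef H x"
  by (simp_all add: star_eq_diag diag_in_quasitubes bounded_coef)

text \<open>\<open>H\<close>-linearity makes \<open>T\<close> diagonal: multiplication by a basis
  vector isolates one coordinate, and \<open>T\<close> commutes with this multiplication.\<close>

lemma coef_quasitube:
  assumes T: "T \<in> quasitubes H"
  shows "coef H (T x) j = tube_coef H T j * coef H x j"
proof -
  have lin: "T (star H a x + star H b y) = star H a (T x) + star H b (T y)" for a b x y
    using T by (simp add: quasitubes_def)
  have T_star: "T (star H a x) = star H a (T x)" for a x
  proof -
    have "star H 0 y = 0" for y by (rule coef_eqI) simp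
    thus ?thesis using lin[of a x 0 x] by simp
  qed
  let ?e = "bas H j"
  \<comment> \<open>The product is rewritten with \<open>?e\<close> as its second factor, so that
    \<open>T\<close> acts on the basis vector alone, which is what \<open>tube_coef\<close>
    records.\<close>
  have "star H ?e x = star H (smul H (coef H x j) ?e) ?e"
    by (rule coef_eqI) (simp add: coef_bas)
  hence "star H ?e (T x) = star H (smul H (coef H x j) ?e) (T ?e)"
    by (metis T_star)
  hence "coef H (star H ?e (T x)) j = coef H (star H (smul H (coef H x j) ?e) (T ?e)) j"
    by simp
  thus ?thesis by (simp add: coef_bas tube_coef_def mult.commute flip: coef_def)
qed

lemma quasitube_eqI:
  assumes "S \<in> quasitubes H" "T \<in> quasitubes H" "\<And>j. tube_coef H S j = tube_coef H T j"
  shows "S = T"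
  by (rule ext, rule coef_eqI) (simp add: coef_quasitube assms)

lemma bounded_tube_coef:
  assumes T: "T \<in> quasitubes H"
  shows "bounded (range (tube_coef H T))"
proof -
  obtain K where K: "\<And>x. norm (T x) \<le> K * norm x" using T by (auto simp: quasitubes_def)
  have "norm (tube_coef H T j) \<le> K" for j
    using norm_bas norm_coef_le[of "T (bas H j)" j] K[of "bas H j"] by (simp add: tube_coef_def coef_def)
  thus ?thesis by (auto simp: bounded_iff)
qed

lemma tube_of_coef_eq: "bounded (range c) \<Longrightarrow> tube_of_coef H c = diag c"
  unfolding tube_of_coef_def
  by (rule the_inv_into_f_eq)
    (auto intro!: inj_onI intro: quasitube_eqI simp: diag_in_quasitubes)

lemma tube_of_coef_in [simp]: "bounded (range c) \<Longrightarrow> tube_of_coef H c \<in> quasitubes H"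
  and tube_coef_tube_of_coef [simp]: "bounded (range c) \<Longrightarrow> tube_coef H (tube_of_coef H c) = c"
  by (simp_all add: tube_of_coef_eq diag_in_quasitubes)

lemma tube_of_coef_tube_coef: "T \<in> quasitubes H \<Longrightarrow> tube_of_coef H (tube_coef H T) = T"
  by (rule quasitube_eqI) (simp_all add: bounded_tube_coef)

lemma tube_coef_add [simp]: "tube_coef H (S + T) j = tube_coef H S j + tube_coef H T j"
  and tube_coef_diff [simp]: "tube_coef H (S - T) j = tube_coef H S j - tube_coef H T j"
  and tube_coef_0 [simp]: "tube_coef H 0 j = 0"
  and tube_coef_id [simp]: "tube_coef H id j = 1"
  and tube_coef_smul [simp]: "tube_coef H (\<lambda>x. smul H c (T x)) j = c * tube_coef H T j"
  by (simp_all add: tube_coef_def ip_add_left ip_diff_left ip_bas ip_smul_left)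

lemma tube_coef_sum: "tube_coef H (sum f F) j = (\<Sum>a\<in>F. tube_coef H (f a) j)"
proof (induction F rule: infinite_finite_induct)
  case (insert x F)
  thus ?case by (simp only: sum.insert tube_coef_add not_False_eq_True)
qed (simp_all only: sum.infinite sum.empty tube_coef_0 not_False_eq_True)

lemma tube_coef_comp [simp]:
  "S \<in> quasitubes H \<Longrightarrow> tube_coef H (S \<circ> T) j = tube_coef H S j * tube_coef H T j"
  unfolding tube_coef_def[of H "S \<circ> T"] tube_coef_def[of H T]
  by (simp add: coef_quasitube flip: coef_def)

lemma comp_in_quasitubes [simp]:
  assumes S: "S \<in> quasitubes H" and T: "T \<in> quasitubes H"
  shows "S \<circ> T \<in> quasitubes H"
proof -
  obtain K where K: "\<And>j. norm (tube_coef H S j) \<le> K"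
    using bounded_tube_coef[OF S] by (auto simp: bounded_iff)
  obtain L where L: "\<And>j. norm (tube_coef H T j) \<le> L"
    using bounded_tube_coef[OF T] by (auto simp: bounded_iff)
  have "0 \<le> K" using K[of 0] norm_ge_zero order_trans by blast
  hence "norm (tube_coef H S j * tube_coef H T j) \<le> K * L" for j
    unfolding norm_mult by (intro mult_mono K L) auto
  hence bd: "bounded (range (\<lambda>j. tube_coef H S j * tube_coef H T j))"
    by (auto simp: bounded_iff)
  have "S \<circ> T = diag (\<lambda>j. tube_coef H S j * tube_coef H T j)"
    by (rule ext, rule coef_eqI) (simp add: coef_diag[OF bd] coef_quasitube S T)
  thus ?thesis using diag_in_quasitubes[OF bd] by simp
qed

lemma star_eq_iff [simp]: "star H x = star H y \<longleftrightarrow> x = y"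
proof
  assume "star H x = star H y"
  hence "tube_coef H (star H x) = tube_coef H (star H y)" by (rule arg_cong)
  thus "x = y" unfolding tube_coef_star by (intro coef_eqI) (rule fun_cong)
qed (rule arg_cong)

lemma the_inv_star [simp]: "the_inv (star H) (star H x) = x"
proof (rule the_inv_f_f)
  show "inj (star H)" by (rule injI) (simp only: star_eq_iff)
qed

lemma star_add: "star H x + star H y = star H (x + y)"
proof (rule ext, rule coef_eqI)
  show "coef H ((star H x + star H y) z) j = coef H (star H (x + y) z) j" for z j
    unfolding plus_fun_apply coef_add coef_star by (rule distrib_right[symmetric])
qed

lemma star_diff: "star H x - star H y = star H (x - y)"
proof (rule ext, rule coef_eqI)
  show "coef H ((star H x - star H y) z) j = coef H (star H (x - y) z) j" for z j
    unfolding minus_apply coef_diff coef_star by (rule left_diff_distrib[symmetric])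
qed

lemma star_zero: "star H 0 = 0"
proof (rule ext, rule coef_eqI)
  show "coef H (star H 0 z) j = coef H (0 z) j" for z j
    unfolding zero_fun_apply coef_zero coef_star by (rule mult_zero_left)
qed

lemma star_sum: "(\<Sum>a\<in>F. star H (f a)) = star H (sum f F)"
  by (induction F rule: infinite_finite_induct)
    (simp_all only: star_add star_zero sum.insert sum.infinite sum.empty not_False_eq_True)

text \<open>Square summability of the symbol decides membership in the embedded copy of the Hilbert
  space; \<open>series\<close> supplies the preimage.\<close>

lemma tube_of_coef_eq_star:
  assumes "square_summable c"
  shows "tube_of_coef H c = star H (series c)"
proof -
  have "c = tube_coef H (star H (series c))" using coef_series[OF assms] by auto
  thus ?thesis using tube_of_coef_tube_coef[of "star H (series c)"] by simp
qed

end


section \<open>Matrices\<close>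

lemma mult_mat_entry:
  assumes "A \<in> carrier_mat m n" "B \<in> carrier_mat n p" "i < m" "j < p"
  shows "(A * B) $$ (i, j) = (\<Sum>a<n. A $$ (i, a) * B $$ (a, j))"
  using assms by (simp add: scalar_prod_def atLeast0LessThan)

lemma mat_adjoint_carrier: "A \<in> carrier_mat m n \<Longrightarrow> mat_adjoint A \<in> carrier_mat n m"
  unfolding mat_adjoint_def by auto

lemma mat_adjoint_entry:
  "A \<in> carrier_mat m n \<Longrightarrow> i < n \<Longrightarrow> j < m \<Longrightarrow> mat_adjoint A $$ (i, j) = conjugate (A $$ (j, i))"
  unfolding mat_adjoint_def by (auto simp: mat_of_rows_def)

definition frobenius_sq :: "'a::real_normed_field mat \<Rightarrow> real" where
  "frobenius_sq A = (\<Sum>i<dim_row A. \<Sum>j<dim_col A. (norm (A $$ (i, j)))\<^sup>2)"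

lemma frobenius_sq_nonneg: "0 \<le> frobenius_sq A"
  by (simp add: frobenius_sq_def sum_nonneg)

lemma sum_mult_squared_le:
  fixes f g :: "'a \<Rightarrow> real"
  assumes "\<And>i. 0 \<le> f i" "\<And>i. 0 \<le> g i"
  shows "(\<Sum>i\<in>I. f i * g i)\<^sup>2 \<le> (\<Sum>i\<in>I. (f i)\<^sup>2) * (\<Sum>i\<in>I. (g i)\<^sup>2)"
proof -
  have "(\<Sum>i\<in>I. f i * g i) \<le> L2_set f I * L2_set g I"
    using L2_set_mult_ineq[of f g I] assms by simp
  hence "(\<Sum>i\<in>I. f i * g i)\<^sup>2 \<le> (L2_set f I * L2_set g I)\<^sup>2"
    using assms by (intro power_mono sum_nonneg mult_nonneg_nonneg)
  thus ?thesis by (simp add: power_mult_distrib L2_set_def sum_nonneg)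
qed

text \<open>Cauchy-Schwarz bounds each entry by a row norm times a column norm, and the sum of these
  products factors. It serves to bound the operator norm by the Hilbert norm.\<close>

lemma frobenius_sq_mult_le:
  assumes A: "A \<in> carrier_mat m n" and B: "B \<in> carrier_mat n p"
  shows "frobenius_sq (A * B) \<le> frobenius_sq A * frobenius_sq B"
proof -
  have entry: "(norm ((A * B) $$ (i, j)))\<^sup>2 \<le>
      (\<Sum>a<n. (norm (A $$ (i, a)))\<^sup>2) * (\<Sum>a<n. (norm (B $$ (a, j)))\<^sup>2)"
    if "i < m" "j < p" for i j
  proof -
    have "norm ((A * B) $$ (i, j)) \<le> (\<Sum>a<n. norm (A $$ (i, a)) * norm (B $$ (a, j)))"
      unfolding mult_mat_entry[OF A B that] norm_mult[symmetric] by (rule norm_sum)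
    hence "(norm ((A * B) $$ (i, j)))\<^sup>2 \<le> (\<Sum>a<n. norm (A $$ (i, a)) * norm (B $$ (a, j)))\<^sup>2"
      by (rule power_mono) (rule norm_ge_zero)
    also have "\<dots> \<le> (\<Sum>a<n. (norm (A $$ (i, a)))\<^sup>2) * (\<Sum>a<n. (norm (B $$ (a, j)))\<^sup>2)"
      by (intro sum_mult_squared_le norm_ge_zero)
    finally show ?thesis .
  qed
  have "frobenius_sq (A * B) = (\<Sum>i<m. \<Sum>j<p. (norm ((A * B) $$ (i, j)))\<^sup>2)"
    using A B by (simp only: frobenius_sq_def carrier_matD index_mult_mat)
  also have "\<dots> \<le> (\<Sum>i<m. \<Sum>j<p. (\<Sum>a<n. (norm (A $$ (i, a)))\<^sup>2) * (\<Sum>a<n. (norm (B $$ (a, j)))\<^sup>2))"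
    by (intro sum_mono entry) auto
  also have "\<dots> = (\<Sum>i<m. \<Sum>a<n. (norm (A $$ (i, a)))\<^sup>2) * (\<Sum>j<p. \<Sum>a<n. (norm (B $$ (a, j)))\<^sup>2)"
    by (rule sum_product[symmetric])
  also have "(\<Sum>j<p. \<Sum>a<n. (norm (B $$ (a, j)))\<^sup>2) = (\<Sum>a<n. \<Sum>j<p. (norm (B $$ (a, j)))\<^sup>2)"
    by (rule sum.swap)
  finally show ?thesis using A B by (simp only: frobenius_sq_def carrier_matD)
qed

text \<open>After expanding the squares, summing over \<open>l\<close> first leaves Kronecker
  deltas: a matrix with orthonormal rows preserves the length of row vectors.\<close>

lemma sum_norm_mult_unitary:
  fixes d :: "nat \<Rightarrow> 'f::real_or_complex"
  assumes v: "\<And>j j'. j < p \<Longrightarrow> j' < p \<Longrightarrow>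
    (\<Sum>l<p. v j l * conjugate (v j' l)) = (if j = j' then 1 else 0)"
  shows "(\<Sum>l<p. (norm (\<Sum>j<p. d j * v j l))\<^sup>2) = (\<Sum>j<p. (norm (d j))\<^sup>2)"
proof -
  have "(of_real (\<Sum>l<p. (norm (\<Sum>j<p. d j * v j l))\<^sup>2) :: 'f) =
      (\<Sum>l<p. (\<Sum>j<p. d j * v j l) * conjugate (\<Sum>j<p. d j * v j l))"
    by (simp only: of_real_sum mult_conjugate_self)
  also have "\<dots> = (\<Sum>l<p. \<Sum>j<p. \<Sum>j'<p. (d j * conjugate (d j')) * (v j l * conjugate (v j' l)))"
    by (simp add: sum_conjugate sum_product conjugate_dist_mul mult_ac)
  also have "\<dots> = (\<Sum>j<p. \<Sum>j'<p. \<Sum>l<p. (d j * conjugate (d j')) * (v j l * conjugate (v j' l)))"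
    by (subst sum.swap, rule sum.cong[OF refl], rule sum.swap)
  also have "\<dots> = (\<Sum>j<p. \<Sum>j'<p. (d j * conjugate (d j')) * (if j = j' then 1 else 0))"
    unfolding sum_distrib_left[symmetric] by (intro sum.cong refl arg_cong2[where f = times] v) auto
  also have "\<dots> = (\<Sum>j<p. d j * conjugate (d j))"
    by (simp add: if_distrib cong: if_cong)
  also have "\<dots> = of_real (\<Sum>j<p. (norm (d j))\<^sup>2)"
    by (simp only: of_real_sum mult_conjugate_self)
  finally show ?thesis by (simp only: of_real_eq_iff)
qed

text \<open>Grouping by the column \<open>l\<close> writes the norm as a sum of squared lengths of
  \<open>D\<close> applied to single columns of \<open>v\<close>, so each right singular vector can
  be treated on its own.\<close>

lemma frobenius_sq_mult_unitary:
  fixes D :: "'f::real_or_complex mat"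
  assumes D: "D \<in> carrier_mat m p" and v: "\<And>j j'. j < p \<Longrightarrow> j' < p \<Longrightarrow>
    (\<Sum>l<p. v j l * conjugate (v j' l)) = (if j = j' then 1 else 0)"
  shows "(\<Sum>l<p. \<Sum>i<m. (norm (\<Sum>j<p. D $$ (i, j) * v j l))\<^sup>2) = frobenius_sq D"
proof -
  have "(\<Sum>l<p. \<Sum>i<m. (norm (\<Sum>j<p. D $$ (i, j) * v j l))\<^sup>2) =
      (\<Sum>i<m. \<Sum>l<p. (norm (\<Sum>j<p. D $$ (i, j) * v j l))\<^sup>2)"
    by (rule sum.swap)
  also have "\<dots> = (\<Sum>i<m. \<Sum>j<p. (norm (D $$ (i, j)))\<^sup>2)"
    by (intro sum.cong refl sum_norm_mult_unitary v)
  finally show ?thesis using D by (simp add: frobenius_sq_def)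
qed

section \<open>Bounded sequences and finite families of unordered sums\<close>

lemma bounded_range_mult:
  fixes f g :: "'i \<Rightarrow> 'a::real_normed_algebra"
  assumes "bounded (range f)" "bounded (range g)"
  shows "bounded (range (\<lambda>k. f k * g k))"
proof -
  obtain K L where K: "\<And>k. norm (f k) \<le> K" and L: "\<And>k. norm (g k) \<le> L"
    using assms by (auto simp: bounded_iff)
  have "norm (f k * g k) \<le> K * L" for k
  proof -
    have "norm (f k * g k) \<le> norm (f k) * norm (g k)" by (rule norm_mult_ineq)
    also have "\<dots> \<le> K * L"
      using order_trans[OF norm_ge_zero K] by (intro mult_mono K L) auto
    finally show ?thesis .
  qed
  thus ?thesis by (auto simp: bounded_iff)
qed

lemma bounded_range_sum:
  fixes f :: "'a \<Rightarrow> 'i \<Rightarrow> 'b::real_normed_vector"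
  assumes "\<And>a. a \<in> F \<Longrightarrow> bounded (range (f a))"
  shows "bounded (range (\<lambda>k. \<Sum>a\<in>F. f a k))"
  using assms
proof (induction F rule: infinite_finite_induct)
  case (insert a F)
  thus ?case using bounded_plus_comp[of "f a" UNIV "\<lambda>k. \<Sum>a\<in>F. f a k"] by simp
qed (auto simp: bounded_iff)


lemma has_sum_finite_sum:
  fixes f :: "'a \<Rightarrow> 'i \<Rightarrow> 'b::topological_comm_monoid_add"
  assumes "\<And>a. a \<in> F \<Longrightarrow> (f a has_sum S a) A"
  shows "((\<lambda>k. \<Sum>a\<in>F. f a k) has_sum (\<Sum>a\<in>F. S a)) A"
  using assms
proof (induction F rule: infinite_finite_induct)
  case (insert a F)
  thus ?case by (simp add: has_sum_add)
qed simp_all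


section \<open>Tensors and their slices\<close>

lemma elements_mat_subset_iff:
  assumes "X \<in> carrier_mat m p"
  shows "elements_mat X \<subseteq> Q \<longleftrightarrow> (\<forall>i<m. \<forall>j<p. X $$ (i, j) \<in> Q)"
proof
  show "\<forall>i<m. \<forall>j<p. X $$ (i, j) \<in> Q" if "elements_mat X \<subseteq> Q"
    using that elements_matI[OF assms] by blast
  show "elements_mat X \<subseteq> Q" if "\<forall>i<m. \<forall>j<p. X $$ (i, j) \<in> Q"
    using that assms by (auto dest!: elements_matD)
qed

lemma quasi_tensors_iff: "X \<in> quasi_tensors H m p \<longleftrightarrow>
    X \<in> carrier_mat m p \<and> (\<forall>i<m. \<forall>j<p. X $$ (i, j) \<in> quasitubes H)"
  by (simp add: quasi_tensors_def elements_mat_subset_iff cong: conj_cong)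

lemma hilbert_tensors_iff: "X \<in> hilbert_tensors H m p \<longleftrightarrow>
    X \<in> carrier_mat m p \<and> (\<forall>i<m. \<forall>j<p. X $$ (i, j) \<in> range (star H))"
  by (simp add: hilbert_tensors_def elements_mat_subset_iff cong: conj_cong)

lemma slice_carrier [simp]: "X \<in> carrier_mat m p \<Longrightarrow> slice H X k \<in> carrier_mat m p"
  by (auto simp: slice_def)

lemma dim_slice [simp]: "dim_row (slice H X k) = dim_row X" "dim_col (slice H X k) = dim_col X"
  by (simp_all add: slice_def)

lemma slice_entry [simp]:
  "i < dim_row X \<Longrightarrow> j < dim_col X \<Longrightarrow> slice H X k $$ (i, j) = tube_coef H (X $$ (i, j)) k"
  by (simp add: slice_def)

lemma hilbert_tensors_carrier: "X \<in> hilbert_tensors H m p \<Longrightarrow> X \<in> carrier_mat m p"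
  by (simp add: hilbert_tensors_def)

lemma quasi_tensors_carrier: "X \<in> quasi_tensors H m p \<Longrightarrow> X \<in> carrier_mat m p"
  by (simp add: quasi_tensors_def)

lemma hilbert_tensorsE:
  assumes "X \<in> hilbert_tensors H m p" "i < m" "j < p"
  obtains x where "X $$ (i, j) = star H x"
proof -
  have "X $$ (i, j) \<in> range (star H)"
    using assms(1)[unfolded hilbert_tensors_iff] assms(2,3) by (elim conjE allE impE)
  thus ?thesis using that by (elim rangeE)
qed

context based_hilbert
begin

lemma hilbert_tensors_subset: "X \<in> hilbert_tensors H m p \<Longrightarrow> X \<in> quasi_tensors H m p"
  unfolding quasi_tensors_iff hilbert_tensors_iff by (metis imageE star_in_quasitubes)

lemma square_summable_tube_in_range_star:
  assumes "T \<in> quasitubes H" "square_summable (tube_coef H T)"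
  shows "T \<in> range (star H)"
  using tube_of_coef_eq_star[OF assms(2)] tube_of_coef_tube_coef[OF assms(1)] by (metis rangeI)

lemma sum_in_range_star:
  assumes "\<And>a. a \<in> F \<Longrightarrow> f a \<in> range (star H)"
  shows "sum f F \<in> range (star H)"
proof -
  have "\<forall>a\<in>F. \<exists>x. f a = star H x" using assms by blast
  then obtain x where "\<And>a. a \<in> F \<Longrightarrow> f a = star H (x a)" by metis
  hence "sum f F = star H (\<Sum>a\<in>F. x a)" unfolding star_sum[symmetric] by (rule sum.cong[OF refl])
  thus ?thesis by (rule range_eqI)
qed

lemma diff_in_hilbert_tensors:
  assumes "X \<in> hilbert_tensors H m p" "Y \<in> hilbert_tensors H m p"
  shows "X - Y \<in> hilbert_tensors H m p"
  unfolding hilbert_tensors_iff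
proof (intro conjI allI impI)
  show "X - Y \<in> carrier_mat m p" using assms by (auto simp: hilbert_tensors_iff)
  fix i j assume ij: "i < m" "j < p"
  obtain x where "X $$ (i, j) = star H x" using hilbert_tensorsE[OF assms(1) ij] .
  moreover obtain y where "Y $$ (i, j) = star H y" using hilbert_tensorsE[OF assms(2) ij] .
  moreover have "(X - Y) $$ (i, j) = X $$ (i, j) - Y $$ (i, j)"
    using hilbert_tensors_carrier[OF assms(2)] ij by (intro index_minus_mat) auto
  ultimately show "(X - Y) $$ (i, j) \<in> range (star H)" by (simp only: star_diff rangeI)
qed

lemma slice_diff_entry:
  assumes "X \<in> carrier_mat m p" "Y \<in> carrier_mat m p" "i < m" "j < p"
  shows "slice H (X - Y) k $$ (i, j) = slice H X k $$ (i, j) - slice H Y k $$ (i, j)"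
proof -
  have "(X - Y) $$ (i, j) = X $$ (i, j) - Y $$ (i, j)"
    using assms by (intro index_minus_mat) auto
  moreover have "slice H (X - Y) k $$ (i, j) = tube_coef H ((X - Y) $$ (i, j)) k"
    using assms by (intro slice_entry) auto
  ultimately have "slice H (X - Y) k $$ (i, j) = tube_coef H (X $$ (i, j)) k - tube_coef H (Y $$ (i, j)) k"
    by (simp only: tube_coef_diff)
  thus ?thesis using assms by simp
qed

text \<open>\<open>tube_of_coef\<close> has a meaning only on bounded sequences, so an operation
  given by slices needs entrywise bounds before the slices of its result can be read off.\<close>

lemma
  assumes A: "\<And>k. A k \<in> carrier_mat m p"
    and bd: "\<And>i j. i < m \<Longrightarrow> j < p \<Longrightarrow> bounded (range (\<lambda>k. A k $$ (i, j)))"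
  shows tensor_of_slices_in: "tensor_of_slices H m p A \<in> quasi_tensors H m p"
    and slice_tensor_of_slices: "slice H (tensor_of_slices H m p A) k = A k"
proof -
  show "tensor_of_slices H m p A \<in> quasi_tensors H m p"
    by (simp add: quasi_tensors_iff tensor_of_slices_def bd)
  show "slice H (tensor_of_slices H m p A) k = A k"
    using A[of k] by (intro eq_matI) (simp_all add: tensor_of_slices_def bd)
qed

lemma bounded_slice_entry:
  assumes "X \<in> quasi_tensors H m n" "i < m" "j < n"
  shows "bounded (range (\<lambda>k. slice H X k $$ (i, j)))"
proof -
  have "slice H X k $$ (i, j) = tube_coef H (X $$ (i, j)) k" for k
    using assms by (intro slice_entry) (auto simp: quasi_tensors_iff)
  thus ?thesis using assms bounded_tube_coef[of "X $$ (i, j)"] by (simp add: quasi_tensors_iff)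
qed

lemma
  assumes X: "X \<in> quasi_tensors H m n" and Y: "Y \<in> quasi_tensors H n p"
  shows tmult_in: "tmult H X Y \<in> quasi_tensors H m p"
    and slice_tmult: "slice H (tmult H X Y) k = slice H X k * slice H Y k"
proof -
  have Xc: "X \<in> carrier_mat m n" and Yc: "Y \<in> carrier_mat n p"
    using X Y by (auto simp: quasi_tensors_iff)
  have c: "slice H X k * slice H Y k \<in> carrier_mat m p" for k
    by (rule mult_carrier_mat[OF slice_carrier[OF Xc] slice_carrier[OF Yc]])
  have bd: "bounded (range (\<lambda>k. (slice H X k * slice H Y k) $$ (i, j)))" if "i < m" "j < p" for i j
  proof -
    have "(slice H X k * slice H Y k) $$ (i, j) =
        (\<Sum>a<n. slice H X k $$ (i, a) * slice H Y k $$ (a, j))" for k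
      by (rule mult_mat_entry) (use Xc Yc that in simp_all)
    moreover have "bounded (range (\<lambda>k. \<Sum>a<n. slice H X k $$ (i, a) * slice H Y k $$ (a, j)))"
      using that by (intro bounded_range_sum bounded_range_mult bounded_slice_entry[OF X]
          bounded_slice_entry[OF Y]) auto
    ultimately show ?thesis by simp
  qed
  have "tmult H X Y = tensor_of_slices H m p (\<lambda>k. slice H X k * slice H Y k)"
    using Xc Yc by (simp add: tmult_def)
  thus "tmult H X Y \<in> quasi_tensors H m p" "slice H (tmult H X Y) k = slice H X k * slice H Y k"
    using tensor_of_slices_in[OF c bd] slice_tensor_of_slices[OF c bd] by simp_all
qed

lemma
  assumes X: "X \<in> quasi_tensors H m n"
  shows tadjoint_in: "tadjoint H X \<in> quasi_tensors H n m"
    and slice_tadjoint: "slice H (tadjoint H X) k = mat_adjoint (slice H X k)"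
proof -
  have Xc: "X \<in> carrier_mat m n" using X by (auto simp: quasi_tensors_iff)
  have c: "mat_adjoint (slice H X k) \<in> carrier_mat n m" for k
    using Xc by (simp add: mat_adjoint_carrier)
  have bd: "bounded (range (\<lambda>k. mat_adjoint (slice H X k) $$ (i, j)))" if "i < n" "j < m" for i j
  proof -
    have "mat_adjoint (slice H X k) $$ (i, j) = conjugate (slice H X k $$ (j, i))" for k
      using Xc that by (intro mat_adjoint_entry[of _ m n]) simp_all
    thus ?thesis using bounded_slice_entry[OF X that(2,1)] by (simp add: bounded_iff)
  qed
  have "tadjoint H X = tensor_of_slices H n m (\<lambda>k. mat_adjoint (slice H X k))"
    using Xc by (simp add: tadjoint_def)
  thus "tadjoint H X \<in> quasi_tensors H n m" "slice H (tadjoint H X) k = mat_adjoint (slice H X k)"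
    using tensor_of_slices_in[OF c bd] slice_tensor_of_slices[OF c bd] by simp_all
qed

lemma slice_tensor_id: "slice H (tensor_id m) k = 1\<^sub>m m"
proof (rule eq_matI)
  fix i j assume "i < dim_row (1\<^sub>m m :: 'f mat)" "j < dim_col (1\<^sub>m m :: 'f mat)"
  hence ij: "i < m" "j < m" by simp_all
  have "slice H (tensor_id m) k $$ (i, j) = tube_coef H (tensor_id m $$ (i, j)) k"
    using ij by (intro slice_entry) (simp_all add: tensor_id_def)
  also have "tensor_id m $$ (i, j) = (if i = j then id else 0 :: 'h \<Rightarrow> 'h)"
    unfolding tensor_id_def using ij by (subst index_mat) simp_all
  also have "tube_coef H \<dots> k = (if i = j then 1 else 0)"
    by (simp only: tube_coef_0 tube_coef_id split: if_split) blast
  finally show "slice H (tensor_id m) k $$ (i, j) = 1\<^sub>m m $$ (i, j)" using ij by simp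
qed (simp_all add: tensor_id_def)

lemma
  assumes "tensor_unitary H m U"
  shows tensor_unitary_in: "U \<in> quasi_tensors H m m"
    and adjoint_mult_slice: "mat_adjoint (slice H U k) * slice H U k = 1\<^sub>m m"
    and slice_mult_adjoint: "slice H U k * mat_adjoint (slice H U k) = 1\<^sub>m m"
proof -
  show U: "U \<in> quasi_tensors H m m" using assms by (simp add: tensor_unitary_def)
  have "slice H (tmult H (tadjoint H U) U) k = 1\<^sub>m m" "slice H (tmult H U (tadjoint H U)) k = 1\<^sub>m m"
    using assms by (simp_all add: tensor_unitary_def slice_tensor_id)
  thus "mat_adjoint (slice H U k) * slice H U k = 1\<^sub>m m" "slice H U k * mat_adjoint (slice H U k) = 1\<^sub>m m"
    by (simp_all only: slice_tmult[OF tadjoint_in[OF U] U] slice_tmult[OF U tadjoint_in[OF U]]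
        slice_tadjoint[OF U])
qed

lemma unitary_columns:
  assumes U: "tensor_unitary H m U" and l: "l < m" "l' < m"
  shows "(\<Sum>i<m. slice H U k $$ (i, l) * conjugate (slice H U k $$ (i, l'))) = (if l = l' then 1 else 0)"
proof -
  have c: "slice H U k \<in> carrier_mat m m"
    using tensor_unitary_in[OF U] by (simp add: quasi_tensors_iff)
  have "(1\<^sub>m m :: 'f mat) $$ (l', l) =
      (\<Sum>i<m. mat_adjoint (slice H U k) $$ (l', i) * slice H U k $$ (i, l))"
    using l mult_mat_entry[OF mat_adjoint_carrier[OF c] c, of l' l]
    unfolding adjoint_mult_slice[OF U] by blast
  also have "\<dots> = (\<Sum>i<m. slice H U k $$ (i, l) * conjugate (slice H U k $$ (i, l')))"
    using l by (intro sum.cong refl) (simp add: mat_adjoint_entry[OF c] mult.commute)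
  finally show ?thesis using l by (auto split: if_splits)
qed

lemma unitary_rows:
  assumes U: "tensor_unitary H m U" and i: "i < m" "i' < m"
  shows "(\<Sum>l<m. slice H U k $$ (i, l) * conjugate (slice H U k $$ (i', l))) = (if i = i' then 1 else 0)"
proof -
  have c: "slice H U k \<in> carrier_mat m m"
    using tensor_unitary_in[OF U] by (simp add: quasi_tensors_iff)
  have "(1\<^sub>m m :: 'f mat) $$ (i, i') =
      (\<Sum>l<m. slice H U k $$ (i, l) * mat_adjoint (slice H U k) $$ (l, i'))"
    using i mult_mat_entry[OF c mat_adjoint_carrier[OF c], of i i']
    unfolding slice_mult_adjoint[OF U] by blast
  also have "\<dots> = (\<Sum>l<m. slice H U k $$ (i, l) * conjugate (slice H U k $$ (i', l)))"
    using i by (intro sum.cong refl) (simp add: mat_adjoint_entry[OF c])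
  finally show ?thesis using i by (auto split: if_splits)
qed


section \<open>Norms of tensors\<close>

text \<open>Parseval in each of the finitely many entries. This is the bridge from the Hilbert norm
  to matrix inequalities in the slices.\<close>

lemma tensor_norm_has_sum:
  assumes A: "A \<in> hilbert_tensors H m p"
  shows "((\<lambda>k. frobenius_sq (slice H A k)) has_sum (tensor_norm H A)\<^sup>2) UNIV"
proof -
  have Ac: "A \<in> carrier_mat m p" using A by (simp add: hilbert_tensors_iff)
  have entry: "((\<lambda>k. (norm (slice H A k $$ (i, j)))\<^sup>2) has_sum
      (norm (the_inv (star H) (A $$ (i, j))))\<^sup>2) UNIV" if "i < m" "j < p" for i j
  proof -
    from A that obtain x where x: "A $$ (i, j) = star H x" by (rule hilbert_tensorsE)
    have "slice H A k $$ (i, j) = coef H x k" for k using that Ac x by simp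
    thus ?thesis using parseval[of x] x by simp
  qed
  have "((\<lambda>k. \<Sum>i<m. \<Sum>j<p. (norm (slice H A k $$ (i, j)))\<^sup>2) has_sum
      (\<Sum>i<m. \<Sum>j<p. (norm (the_inv (star H) (A $$ (i, j))))\<^sup>2)) UNIV"
    by (intro has_sum_finite_sum entry) auto
  moreover have "(tensor_norm H A)\<^sup>2 = (\<Sum>i<m. \<Sum>j<p. (norm (the_inv (star H) (A $$ (i, j))))\<^sup>2)"
    using Ac by (simp add: tensor_norm_def sum_nonneg)
  moreover have "frobenius_sq (slice H A k) = (\<Sum>i<m. \<Sum>j<p. (norm (slice H A k $$ (i, j)))\<^sup>2)" for k
    using Ac by (simp only: frobenius_sq_def dim_slice carrier_matD)
  ultimately show ?thesis by simp
qed

lemma tensor_norm_nonneg: "0 \<le> tensor_norm H A"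
  by (simp add: tensor_norm_def sum_nonneg)

lemma sum_frobenius_sq_slice_le:
  assumes "A \<in> hilbert_tensors H m p" "finite K"
  shows "(\<Sum>k\<in>K. frobenius_sq (slice H A k)) \<le> (tensor_norm H A)\<^sup>2"
  by (rule finite_sum_le_has_sum[OF tensor_norm_has_sum[OF assms(1)] assms(2)])
    (auto simp: frobenius_sq_nonneg)

text \<open>Each entry is a finite sum of products \<open>star H (x a) (y a)\<close>, and such a
  product is again a vector of the Hilbert space.\<close>

lemma tmult_in_hilbert:
  assumes X: "X \<in> hilbert_tensors H m n" and Y: "Y \<in> hilbert_tensors H n p"
  shows "tmult H X Y \<in> hilbert_tensors H m p"
  unfolding hilbert_tensors_iff
proof (intro conjI allI impI)
  have Xq: "X \<in> quasi_tensors H m n" and Yq: "Y \<in> quasi_tensors H n p"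
    using X Y by (simp_all add: hilbert_tensors_subset)
  hence Xc: "X \<in> carrier_mat m n" and Yc: "Y \<in> carrier_mat n p"
    by (simp_all add: quasi_tensors_iff)
  have M: "tmult H X Y \<in> quasi_tensors H m p" by (rule tmult_in[OF Xq Yq])
  thus Mc: "tmult H X Y \<in> carrier_mat m p" by (simp add: quasi_tensors_iff)
  fix i j assume ij: "i < m" "j < p"
  define x y where "x a = the_inv (star H) (X $$ (i, a))"
    and "y a = the_inv (star H) (Y $$ (a, j))" for a
  have x: "X $$ (i, a) = star H (x a)" if "a < n" for a
    using hilbert_tensorsE[OF X ij(1) that] by (metis x_def the_inv_star)
  have y: "Y $$ (a, j) = star H (y a)" if "a < n" for a
    using hilbert_tensorsE[OF Y that ij(2)] by (metis y_def the_inv_star)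
  have "tube_coef H (tmult H X Y $$ (i, j)) k = coef H (\<Sum>a<n. star H (x a) (y a)) k" for k
  proof -
    have "tube_coef H (tmult H X Y $$ (i, j)) k = slice H (tmult H X Y) k $$ (i, j)"
      using Mc ij by simp
    also have "\<dots> = (\<Sum>a<n. slice H X k $$ (i, a) * slice H Y k $$ (a, j))"
      unfolding slice_tmult[OF Xq Yq] by (rule mult_mat_entry) (use Xc Yc ij in simp_all)
    also have "\<dots> = (\<Sum>a<n. coef H (x a) k * coef H (y a) k)"
      using Xc Yc ij by (intro sum.cong refl) (simp add: x y)
    finally show ?thesis by simp
  qed
  hence "tube_coef H (tmult H X Y $$ (i, j)) = coef H (\<Sum>a<n. star H (x a) (y a))" by (rule ext)
  thus "tmult H X Y $$ (i, j) \<in> range (star H)"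
    using M ij square_summable_coef by (intro square_summable_tube_in_range_star)
      (simp_all add: quasi_tensors_iff)
qed

text \<open>A single slice of \<open>Y\<close> is one summand of its squared norm, so it may be
  replaced by the full norm in every slice; only the slices of \<open>X\<close> remain to be
  summed.\<close>

lemma tensor_norm_tmult_le:
  assumes X: "X \<in> hilbert_tensors H m n" and Y: "Y \<in> hilbert_tensors H n p"
  shows "tensor_norm H (tmult H X Y) \<le> tensor_norm H X * tensor_norm H Y"
proof (rule power2_le_imp_le)
  have Xq: "X \<in> quasi_tensors H m n" and Yq: "Y \<in> quasi_tensors H n p"
    using X Y by (simp_all add: hilbert_tensors_subset)
  hence Xc: "X \<in> carrier_mat m n" and Yc: "Y \<in> carrier_mat n p"
    by (simp_all add: quasi_tensors_iff)
  have le: "frobenius_sq (slice H (tmult H X Y) k) \<le> frobenius_sq (slice H X k) * (tensor_norm H Y)\<^sup>2" for k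
  proof -
    have "frobenius_sq (slice H (tmult H X Y) k) \<le> frobenius_sq (slice H X k) * frobenius_sq (slice H Y k)"
      unfolding slice_tmult[OF Xq Yq]
      by (rule frobenius_sq_mult_le[OF slice_carrier[OF Xc] slice_carrier[OF Yc]])
    also have "\<dots> \<le> frobenius_sq (slice H X k) * (tensor_norm H Y)\<^sup>2"
      using sum_frobenius_sq_slice_le[OF Y, of "{k}"]
      by (intro mult_left_mono frobenius_sq_nonneg) simp
    finally show ?thesis .
  qed
  have "((\<lambda>k. frobenius_sq (slice H X k) * (tensor_norm H Y)\<^sup>2) has_sum
      (tensor_norm H X)\<^sup>2 * (tensor_norm H Y)\<^sup>2) UNIV"
    by (intro has_sum_cmult_left tensor_norm_has_sum[OF X])
  from has_sum_mono[OF tensor_norm_has_sum[OF tmult_in_hilbert[OF X Y]] this le]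
  show "(tensor_norm H (tmult H X Y))\<^sup>2 \<le> (tensor_norm H X * tensor_norm H Y)\<^sup>2"
    by (simp only: power_mult_distrib)
qed (simp add: tensor_norm_nonneg)

lemma tensor_op_norm_bounds:
  assumes B: "B \<in> hilbert_tensors H m p" and p: "0 < p"
  shows "0 \<le> tensor_op_norm H B" "tensor_op_norm H B \<le> tensor_norm H B"
proof -
  let ?S = "{Z \<in> hilbert_tensors H p 1. tensor_norm H Z = 1}"
  have dim: "dim_col B = p" using B by (auto simp: hilbert_tensors_iff)
  have le: "tensor_norm H (tmult H B Z) \<le> tensor_norm H B" if "Z \<in> ?S" for Z
    using tensor_norm_tmult_le[OF B, of Z 1] that by simp
  \<comment> \<open>A unit column with a basis vector in row 0. It makes the index set of the
    supremum nonempty, and its value supplies the lower bound 0.\<close>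
  define E where "E = Matrix.mat p 1 (\<lambda>(i, j). star H (if i = 0 then bas H 0 else 0))"
  have E: "E \<in> hilbert_tensors H p 1"
    by (simp add: hilbert_tensors_iff E_def)
  have "(\<Sum>i<p. \<Sum>j<1. (norm (the_inv (star H) (E $$ (i, j))))\<^sup>2) = (\<Sum>i<p. if i = 0 then 1 else 0)"
    by (intro sum.cong refl) (simp add: E_def)
  also have "\<dots> = 1" using p by simp
  finally have "tensor_norm H E = 1" by (simp add: tensor_norm_def E_def)
  hence ES: "E \<in> ?S" using E by simp
  show "tensor_op_norm H B \<le> tensor_norm H B"
    unfolding tensor_op_norm_def dim using ES le by (intro cSUP_least) blast+
  have "0 \<le> tensor_norm H (tmult H B E)" by (rule tensor_norm_nonneg)
  also have "\<dots> \<le> tensor_op_norm H B"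
    unfolding tensor_op_norm_def dim using ES le by (intro cSUP_upper bdd_aboveI2) blast+
  finally show "0 \<le> tensor_op_norm H B" .
qed

end


section \<open>The truncated singular value decomposition\<close>

locale truncated_svd = based_hilbert H
  for H :: "('f::real_or_complex, 'h::banach) based_space" +
  fixes m p :: nat
    and X U S V :: "('h \<Rightarrow> 'h) mat"
    and idx :: "nat \<Rightarrow> nat \<times> int"
  assumes X: "X \<in> hilbert_tensors H m p"
    and svd: "qsvd H m p X U S V"
    and enum: "sing_val_enum H m p S idx"
    and pos: "0 < m" "0 < p"
begin

abbreviation r :: nat where "r \<equiv> min m p"

abbreviation u :: "int \<Rightarrow> nat \<Rightarrow> nat \<Rightarrow> 'f" where "u t i l \<equiv> slice H U t $$ (i, l)"

abbreviation v :: "int \<Rightarrow> nat \<Rightarrow> nat \<Rightarrow> 'f" where "v t j l \<equiv> slice H V t $$ (j, l)"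

definition sq_sing :: "nat \<times> int \<Rightarrow> real" where "sq_sing x = (norm (sing_val H S x))\<^sup>2"

abbreviation trunc :: "nat \<Rightarrow> ('h \<Rightarrow> 'h) mat" where "trunc q \<equiv> truncation H U S V idx q"

lemma U: "tensor_unitary H m U" and V: "tensor_unitary H p V"
  and S: "S \<in> quasi_tensors H m p" and S_diag: "diagonal_mat (slice H S k)"
  and X_eq: "X = tmult H (tmult H U S) (tadjoint H V)"
  using svd by (simp_all add: qsvd_def f_diagonal_def)

lemmas U_in = tensor_unitary_in[OF U] and V_in = tensor_unitary_in[OF V]

lemmas carriers = quasi_tensors_carrier[OF U_in] quasi_tensors_carrier[OF V_in]
  quasi_tensors_carrier[OF S] hilbert_tensors_carrier[OF X]

lemma inj_idx: "inj_on idx {1..}"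
  and idx_range: "idx ` {1..} \<subseteq> {..<r} \<times> UNIV"
  and sing_val_step: "1 \<le> n \<Longrightarrow> sing_val H S (idx (Suc n)) \<le> sing_val H S (idx n)"
  and sing_val_nonneg: "1 \<le> n \<Longrightarrow> 0 \<le> sing_val H S (idx n)"
  and idx_covers: "{x \<in> {..<r} \<times> UNIV. sing_val H S x \<noteq> 0} \<subseteq> idx ` {1..}"
  using enum unfolding sing_val_enum_def by simp_all

lemma fst_idx_less: "1 \<le> n \<Longrightarrow> fst (idx n) < r"
  using idx_range by (auto simp: image_subset_iff mem_Times_iff)

lemma sq_sing_antimono:
  assumes "1 \<le> n" "n \<le> k"
  shows "sq_sing (idx k) \<le> sq_sing (idx n)"
  using assms(2)
proof (induction k rule: dec_induct)
  case (step k)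
  have "1 \<le> k" using assms(1) step.hyps by simp
  hence "norm (sing_val H S (idx (Suc k))) \<le> norm (sing_val H S (idx k))"
    by (intro norm_mono_nonneg sing_val_step sing_val_nonneg) simp_all
  hence "sq_sing (idx (Suc k)) \<le> sq_sing (idx k)"
    unfolding sq_sing_def by (rule power_mono) (rule norm_ge_zero)
  thus ?case using step.IH by simp
qed simp

text \<open>Cancelling the unitary \<open>V\<close> turns the factorization into
  \<open>X V = U S\<close>, read off in column \<open>l\<close>. The case distinction comes from the
  rectangular shape: for \<open>m \<le> l\<close> column \<open>l\<close> of the diagonal factor is
  0.\<close>

lemma X_mult_v:
  assumes "i < m" "l < p"
  shows "(\<Sum>j<p. slice H X t $$ (i, j) * v t j l) =
    (if l < m then sing_val H S (l, t) * u t i l else 0)"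
proof -
  let ?U = "slice H U t" and ?S = "slice H S t" and ?V = "slice H V t"
  have c: "?U \<in> carrier_mat m m" "?S \<in> carrier_mat m p" "?V \<in> carrier_mat p p"
    "slice H X t \<in> carrier_mat m p"
    using carriers by simp_all
  note ca = mat_adjoint_carrier[OF c(3)]
  have "slice H X t = ?U * ?S * mat_adjoint ?V"
    unfolding X_eq slice_tmult[OF tmult_in[OF U_in S] tadjoint_in[OF V_in]]
      slice_tmult[OF U_in S] slice_tadjoint[OF V_in] ..
  hence "slice H X t * ?V = ?U * ?S * (mat_adjoint ?V * ?V)"
    using assoc_mult_mat[OF mult_carrier_mat[OF c(1,2)] ca c(3)] by simp
  also have "\<dots> = ?U * ?S"
    unfolding adjoint_mult_slice[OF V] by (rule right_mult_one_mat[OF mult_carrier_mat[OF c(1,2)]])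
  finally have XV: "slice H X t * ?V = ?U * ?S" .
  have "(\<Sum>j<p. slice H X t $$ (i, j) * v t j l) = (slice H X t * ?V) $$ (i, l)"
    by (rule mult_mat_entry[OF c(4,3) assms, symmetric])
  also have "\<dots> = (\<Sum>a<m. ?U $$ (i, a) * ?S $$ (a, l))"
    unfolding XV by (rule mult_mat_entry[OF c(1,2) assms])
  also have "\<dots> = (\<Sum>a<m. if a = l then ?U $$ (i, l) * ?S $$ (l, l) else 0)"
  proof (rule sum.cong[OF refl])
    fix a assume "a \<in> {..<m}"
    moreover have "?S $$ (a, l) = 0" if "a < m" "a \<noteq> l"
      using S_diag[of t] that assms unfolding diagonal_mat_def carrier_matD[OF c(2)]
      by (simp del: slice_entry)
    ultimately show "?U $$ (i, a) * ?S $$ (a, l) = (if a = l then ?U $$ (i, l) * ?S $$ (l, l) else 0)"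
      by auto
  qed
  also have "\<dots> = (if l < m then sing_val H S (l, t) * u t i l else 0)"
    by (simp add: sing_val_def mult.commute)
  finally show ?thesis .
qed

text \<open>The factor given by the basis vector \<open>bas H t\<close> deletes all slices but slice
  \<open>t\<close>, where a multiple of the outer product of two singular vectors remains.\<close>

lemma
  assumes l: "l < r"
  shows trunc_term_in: "trunc_term H U S V (l, t) \<in> hilbert_tensors H m p"
    and slice_trunc_term: "i < m \<Longrightarrow> j < p \<Longrightarrow> slice H (trunc_term H U S V (l, t)) k $$ (i, j) =
      (if k = t then sing_val H S (l, t) * u t i l * conjugate (v t j l) else 0)"
proof -
  let ?x = "smul H (sing_val H S (l, t)) (bas H t)"
  define A where "A = tube_times_tensor (star H ?x) (tensor_col U l)"
  define B where "B = tensor_col V l"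
  have lm: "l < m" "l < p" using l by simp_all
  have U_q: "U $$ (i, l) \<in> quasitubes H" if "i < m" for i
    using U_in lm that by (simp add: quasi_tensors_iff)
  have A: "A \<in> quasi_tensors H m 1"
    using carriers(1) U_q by (simp add: quasi_tensors_iff A_def tube_times_tensor_def tensor_col_def)
  have B: "B \<in> quasi_tensors H p 1"
    using V_in carriers(2) lm by (simp add: quasi_tensors_iff B_def tensor_col_def)
  have A_e: "slice H A k $$ (i, 0) = (if k = t then sing_val H S (l, t) * u t i l else 0)"
    if "i < m" for i k
    using that carriers(1) lm
    by (simp add: A_def tube_times_tensor_def tensor_col_def coef_bas)
  have B_e: "mat_adjoint (slice H B k) $$ (0, j) = conjugate (v k j l)" if "j < p" for j k
  proof -
    have "mat_adjoint (slice H B k) $$ (0, j) = conjugate (slice H B k $$ (j, 0))"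
      by (rule mat_adjoint_entry[of _ p 1]) (use quasi_tensors_carrier[OF B] that in simp_all)
    also have "slice H B k $$ (j, 0) = v k j l"
      using that carriers(2) lm by (simp add: B_def tensor_col_def)
    finally show ?thesis .
  qed
  have T: "trunc_term H U S V (l, t) = tmult H A (tadjoint H B)"
    by (simp add: trunc_term_def A_def B_def)
  have Tq: "trunc_term H U S V (l, t) \<in> quasi_tensors H m p"
    unfolding T by (rule tmult_in[OF A tadjoint_in[OF B]])
  show e: "slice H (trunc_term H U S V (l, t)) k $$ (i, j) =
      (if k = t then sing_val H S (l, t) * u t i l * conjugate (v t j l) else 0)"
    if "i < m" "j < p" for i j k
  proof -
    have "slice H (trunc_term H U S V (l, t)) k $$ (i, j) =
        (\<Sum>a<1. slice H A k $$ (i, a) * mat_adjoint (slice H B k) $$ (a, j))"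
      unfolding T slice_tmult[OF A tadjoint_in[OF B]] slice_tadjoint[OF B]
      by (rule mult_mat_entry[OF slice_carrier[OF quasi_tensors_carrier[OF A]]
        mat_adjoint_carrier[OF slice_carrier[OF quasi_tensors_carrier[OF B]]] that])
    thus ?thesis using that by (simp add: A_e B_e)
  qed
  have "trunc_term H U S V (l, t) $$ (i, j) \<in> range (star H)" if "i < m" "j < p" for i j
  proof (rule square_summable_tube_in_range_star)
    show "trunc_term H U S V (l, t) $$ (i, j) \<in> quasitubes H"
      using Tq that by (simp add: quasi_tensors_iff)
    \<comment> \<open>The symbol is supported at the single index \<open>t\<close>, hence
      square-summable, although the entries of \<open>U\<close> and \<open>V\<close> are merely
      bounded.\<close>
    have "tube_coef H (trunc_term H U S V (l, t) $$ (i, j)) k = 0" if "k \<noteq> t" for k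
      using e[OF \<open>i < m\<close> \<open>j < p\<close>, of k] that \<open>i < m\<close> \<open>j < p\<close> quasi_tensors_carrier[OF Tq] by simp
    hence "{k. (norm (tube_coef H (trunc_term H U S V (l, t) $$ (i, j)) k))\<^sup>2 \<noteq> 0} \<subseteq> {t}" by auto
    thus "square_summable (tube_coef H (trunc_term H U S V (l, t) $$ (i, j)))"
      unfolding square_summable_def
      by (intro finite_nonzero_values_imp_summable_on) (auto intro: finite_subset)
  qed
  thus "trunc_term H U S V (l, t) \<in> hilbert_tensors H m p"
    using quasi_tensors_carrier[OF Tq] by (simp add: hilbert_tensors_iff)
qed

section \<open>Slices of the truncation and of the residual\<close>

lemma trunc_entry:
  "i < m \<Longrightarrow> j < p \<Longrightarrow> trunc q $$ (i, j) = (\<Sum>n=1..q. trunc_term H U S V (idx n) $$ (i, j))"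
  unfolding truncation_def using carriers by (subst index_mat) simp_all

lemma trunc_term_idx_in: "1 \<le> n \<Longrightarrow> trunc_term H U S V (idx n) \<in> hilbert_tensors H m p"
  using trunc_term_in[OF fst_idx_less, of n "snd (idx n)"] by simp

lemma trunc_in: "trunc q \<in> hilbert_tensors H m p"
  unfolding hilbert_tensors_iff
proof (intro conjI allI impI)
  show "trunc q \<in> carrier_mat m p" using carriers by (simp add: truncation_def)
  fix i j assume ij: "i < m" "j < p"
  have "trunc_term H U S V (idx n) $$ (i, j) \<in> range (star H)" if "n \<in> {1..q}" for n
    using trunc_term_idx_in[of n] that ij by (simp add: hilbert_tensors_iff)
  thus "trunc q $$ (i, j) \<in> range (star H)"
    unfolding trunc_entry[OF ij] by (rule sum_in_range_star)
qed

lemma slice_trunc: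
  assumes ij: "i < m" "j < p"
  shows "slice H (trunc q) k $$ (i, j) = (\<Sum>n=1..q. if snd (idx n) = k
    then sing_val H S (idx n) * u k i (fst (idx n)) * conjugate (v k j (fst (idx n))) else 0)"
proof -
  have "slice H (trunc q) k $$ (i, j) = tube_coef H (trunc q $$ (i, j)) k"
    using hilbert_tensors_carrier[OF trunc_in, of q] ij by (intro slice_entry) simp_all
  also have "\<dots> = (\<Sum>n=1..q. tube_coef H (trunc_term H U S V (idx n) $$ (i, j)) k)"
    unfolding trunc_entry[OF ij] by (rule tube_coef_sum)
  also have "\<dots> = (\<Sum>n=1..q. if snd (idx n) = k
    then sing_val H S (idx n) * u k i (fst (idx n)) * conjugate (v k j (fst (idx n))) else 0)"
  proof (rule sum.cong[OF refl])
    fix n assume "n \<in> {1..q}"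
    hence n: "1 \<le> n" by simp
    have "tube_coef H (trunc_term H U S V (idx n) $$ (i, j)) k = slice H (trunc_term H U S V (idx n)) k $$ (i, j)"
      using hilbert_tensors_carrier[OF trunc_term_idx_in[OF n]] ij by simp
    thus "tube_coef H (trunc_term H U S V (idx n) $$ (i, j)) k = (if snd (idx n) = k
        then sing_val H S (idx n) * u k i (fst (idx n)) * conjugate (v k j (fst (idx n))) else 0)"
      using slice_trunc_term[OF fst_idx_less[OF n] ij, of "snd (idx n)" k] by auto
  qed
  finally show ?thesis .
qed

text \<open>Orthonormality of the columns of \<open>V\<close> in slice \<open>t\<close> removes
  every term except the one with \<open>idx n = (l, t)\<close>, and injectivity of
  \<open>idx\<close> lets it occur at most once.\<close>

lemma trunc_mult_v:
  assumes i: "i < m" and l: "l < p"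
  shows "(\<Sum>j<p. slice H (trunc q) t $$ (i, j) * v t j l) =
    (if (l, t) \<in> idx ` {1..q} then sing_val H S (l, t) * u t i l else 0)"
proof -
  let ?g = "\<lambda>x. if x = (l, t) then sing_val H S (l, t) * u t i l else 0"
  have summand: "(\<Sum>j<p. (if snd (idx n) = t
      then sing_val H S (idx n) * u t i (fst (idx n)) * conjugate (v t j (fst (idx n))) else 0) * v t j l)
      = ?g (idx n)" if "n \<in> {1..q}" for n
  proof (cases "snd (idx n) = t")
    case True
    have f: "fst (idx n) < p" using fst_idx_less[of n] that by simp
    have "(\<Sum>j<p. (if snd (idx n) = t
      then sing_val H S (idx n) * u t i (fst (idx n)) * conjugate (v t j (fst (idx n))) else 0) * v t j l)
      = sing_val H S (idx n) * u t i (fst (idx n)) * (\<Sum>j<p. v t j l * conjugate (v t j (fst (idx n))))"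
      using True by (simp add: sum_distrib_left mult_ac)
    also have "\<dots> = ?g (idx n)"
      using True unitary_columns[OF V l f, of t] by (auto simp: prod_eq_iff)
    finally show ?thesis .
  qed (auto simp: prod_eq_iff)
  have "(\<Sum>j<p. slice H (trunc q) t $$ (i, j) * v t j l) =
      (\<Sum>j<p. \<Sum>n=1..q. (if snd (idx n) = t
      then sing_val H S (idx n) * u t i (fst (idx n)) * conjugate (v t j (fst (idx n))) else 0) * v t j l)"
    using i by (intro sum.cong refl) (simp only: slice_trunc sum_distrib_right lessThan_iff)
  also have "\<dots> = (\<Sum>n=1..q. ?g (idx n))"
    by (subst sum.swap) (rule sum.cong[OF refl summand])
  also have "\<dots> = sum ?g (idx ` {1..q})"
    using inj_on_subset[OF inj_idx, of "{1..q}"] by (subst sum.reindex) auto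
  also have "\<dots> = (if (l, t) \<in> idx ` {1..q} then sing_val H S (l, t) * u t i l else 0)"
    by simp
  finally show ?thesis .
qed

lemma sum_norm_u:
  assumes "l < m"
  shows "(\<Sum>i<m. (norm (u t i l))\<^sup>2) = 1"
proof -
  have "(of_real (\<Sum>i<m. (norm (u t i l))\<^sup>2) :: 'f) = of_real 1"
    using unitary_columns[OF U assms assms, of t] by (simp add: mult_conjugate_self)
  thus ?thesis unfolding of_real_eq_iff .
qed

lemma frobenius_sq_slice:
  assumes D: "D \<in> hilbert_tensors H m p"
  shows "frobenius_sq (slice H D t) = (\<Sum>l<p. \<Sum>i<m. (norm (\<Sum>j<p. slice H D t $$ (i, j) * v t j l))\<^sup>2)"
  by (rule frobenius_sq_mult_unitary[symmetric, OF slice_carrier[OF hilbert_tensors_carrier[OF D]]])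
    (rule unitary_rows[OF V])

lemma sum_diff_slice:
  assumes "Y \<in> hilbert_tensors H m p" "i < m"
  shows "(\<Sum>j<p. slice H (X - Y) t $$ (i, j) * c j) =
    (\<Sum>j<p. slice H X t $$ (i, j) * c j) - (\<Sum>j<p. slice H Y t $$ (i, j) * c j)"
  unfolding sum_subtractf[symmetric] using assms
  by (intro sum.cong refl)
    (simp only: slice_diff_entry[OF carriers(4) hilbert_tensors_carrier] left_diff_distrib lessThan_iff)

text \<open>The residual sends a right singular vector to its singular value times the left one if
  the pair was not selected, and to 0 otherwise. Left singular vectors have length 1, so only
  squared singular values are left.\<close>

lemma frobenius_sq_residual:
  "frobenius_sq (slice H (X - trunc q) t) =
    (\<Sum>l<r. if (l, t) \<in> idx ` {1..q} then 0 else sq_sing (l, t))"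
proof -
  have "frobenius_sq (slice H (X - trunc q) t) =
      (\<Sum>l<p. if l < m \<and> (l, t) \<notin> idx ` {1..q} then sq_sing (l, t) else 0)"
    unfolding frobenius_sq_slice[OF diff_in_hilbert_tensors[OF X trunc_in]]
  proof (rule sum.cong[OF refl])
    fix l assume "l \<in> {..<p}"
    hence l: "l < p" by simp
    have idx_m: "l < m" if "(l, t) \<in> idx ` {1..q}"
    proof -
      from that obtain n where "(l, t) = idx n" "n \<in> {1..q}" by (rule imageE)
      thus ?thesis using fst_idx_less[of n] by (metis atLeastAtMost_iff fst_conv min_less_iff_conj)
    qed
    let ?c = "if l < m \<and> (l, t) \<notin> idx ` {1..q} then sing_val H S (l, t) else 0"
    have "(\<Sum>i<m. (norm (\<Sum>j<p. slice H (X - trunc q) t $$ (i, j) * v t j l))\<^sup>2) =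
        (\<Sum>i<m. (norm (?c * u t i l))\<^sup>2)"
    proof (rule sum.cong[OF refl])
      fix i assume "i \<in> {..<m}"
      hence i: "i < m" by simp
      have "(\<Sum>j<p. slice H (X - trunc q) t $$ (i, j) * v t j l) = ?c * u t i l"
        unfolding sum_diff_slice[OF trunc_in i] X_mult_v[OF i l] trunc_mult_v[OF i l]
        using idx_m by auto
      thus "(norm (\<Sum>j<p. slice H (X - trunc q) t $$ (i, j) * v t j l))\<^sup>2 = (norm (?c * u t i l))\<^sup>2"
        by (rule arg_cong)
    qed
    also have "\<dots> = (norm ?c)\<^sup>2 * (\<Sum>i<m. (norm (u t i l))\<^sup>2)"
      by (simp only: norm_mult power_mult_distrib sum_distrib_left)
    also have "\<dots> = (if l < m \<and> (l, t) \<notin> idx ` {1..q} then sq_sing (l, t) else 0)"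
      using sum_norm_u[of l t] by (auto simp: sq_sing_def)
    finally show "(\<Sum>i<m. (norm (\<Sum>j<p. slice H (X - trunc q) t $$ (i, j) * v t j l))\<^sup>2) =
        (if l < m \<and> (l, t) \<notin> idx ` {1..q} then sq_sing (l, t) else 0)" .
  qed
  also have "\<dots> = (\<Sum>l<r. if (l, t) \<in> idx ` {1..q} then 0 else sq_sing (l, t))"
    by (rule sum.mono_neutral_cong_right) auto
  finally show ?thesis .
qed

section \<open>Sums of the squared singular values\<close>

lemma residual_has_sum:
  "((\<lambda>t. \<Sum>l<r. if (l, t) \<in> idx ` {1..q} then 0 else sq_sing (l, t)) has_sum
    (tensor_norm H (X - trunc q))\<^sup>2) UNIV"
  using tensor_norm_has_sum[OF diff_in_hilbert_tensors[OF X trunc_in[of q]]]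
  by (simp only: frobenius_sq_residual)

text \<open>\<open>trunc 0\<close> is the zero tensor, so this is the squared norm of
  \<open>X\<close>, written as a residual to make \<open>residual_has_sum\<close> applicable with
  \<open>q = 0\<close>.\<close>

definition total :: real where "total = (tensor_norm H (X - trunc 0))\<^sup>2"

lemma sq_sing_nonneg: "0 \<le> sq_sing x"
  by (simp add: sq_sing_def)

lemma total_has_sum: "((\<lambda>t. \<Sum>l<r. sq_sing (l, t)) has_sum total) UNIV"
  using residual_has_sum[of 0] by (simp add: total_def)

text \<open>Non-negativity merges the slicewise sums into one unordered sum over pairs. Pairs missed
  by the enumeration have singular value 0, so the sum may be restricted to its image.\<close>

lemma sq_sing_has_sum: "(sq_sing has_sum total) (idx ` {1..})"
proof -
  have 1: "((\<lambda>l. sq_sing (l, t)) has_sum (\<Sum>l<r. sq_sing (l, t))) {..<r}" for t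
    by (rule has_sum_finite) simp
  have "((\<lambda>(t, l). sq_sing (l, t)) has_sum total) (UNIV \<times> {..<r})"
  proof (rule has_sum_SigmaI)
    show "((\<lambda>l. case (t, l) of (t, l) \<Rightarrow> sq_sing (l, t)) has_sum (\<Sum>l<r. sq_sing (l, t))) {..<r}" for t
      using 1 by simp
    show "((\<lambda>t. \<Sum>l<r. sq_sing (l, t)) has_sum total) UNIV" by (rule total_has_sum)
    show "(\<lambda>(t, l). sq_sing (l, t)) summable_on UNIV \<times> {..<r}"
    proof (rule summable_on_SigmaI)
      show "((\<lambda>l. case (t, l) of (t, l) \<Rightarrow> sq_sing (l, t)) has_sum (\<Sum>l<r. sq_sing (l, t))) {..<r}" for t
        using 1 by simp
      show "(\<lambda>t. \<Sum>l<r. sq_sing (l, t)) summable_on UNIV"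
        using total_has_sum by (rule has_sum_imp_summable)
    qed (simp add: sq_sing_nonneg)
  qed
  hence "(sq_sing has_sum total) ({..<r} \<times> UNIV)"
    by (subst has_sum_swap)
  moreover have "(sq_sing has_sum total) ({..<r} \<times> UNIV) \<longleftrightarrow> (sq_sing has_sum total) (idx ` {1..})"
  proof (rule has_sum_cong_neutral)
    fix x assume "x \<in> {..<r} \<times> UNIV - idx ` {1..}"
    hence "sing_val H S x = 0" using idx_covers by blast
    thus "sq_sing x = 0" by (simp add: sq_sing_def)
  next
    fix x assume "x \<in> idx ` {1..} - {..<r} \<times> UNIV"
    thus "sq_sing x = 0" using idx_range by blast
  qed simp
  ultimately show ?thesis by simp
qed

lemma sum_sq_sing_tendsto: "(\<lambda>N. \<Sum>n=1..N. sq_sing (idx n)) \<longlonglongrightarrow> total"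
proof -
  \<comment> \<open>The enumeration starts at 1 and a series at 0; reindexing by \<open>Suc\<close>
    accounts for the shift.\<close>
  have "((sq_sing \<circ> idx) has_sum total) (Suc ` UNIV)"
  proof -
    have "Suc ` UNIV = {1..}" by (auto simp: image_iff) (metis Suc_pred' Suc_le_eq)
    thus ?thesis using sq_sing_has_sum has_sum_reindex[OF inj_idx, of sq_sing total] by simp
  qed
  hence "((sq_sing \<circ> idx) \<circ> Suc has_sum total) UNIV"
    by (subst (asm) has_sum_reindex) simp_all
  hence "(\<lambda>N. \<Sum>n<N. sq_sing (idx (Suc n))) \<longlonglongrightarrow> total"
    using has_sum_imp_sums by (fastforce simp: sums_def)
  moreover have "(\<Sum>n<N. sq_sing (idx (Suc n))) = (\<Sum>n=1..N. sq_sing (idx n))" for N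
    by (simp add: sum.atLeast1_atMost_eq)
  ultimately show ?thesis by simp
qed

text \<open>The selected squares form a sum over slices with finitely many nonzero terms. Added to
  the sum for the residual they restore the sum over all pairs, and sums are unique.\<close>

lemma residual_norm: "(tensor_norm H (X - trunc q))\<^sup>2 = total - (\<Sum>n=1..q. sq_sing (idx n))"
proof -
  let ?I = "idx ` {1..q}"
  have "((\<lambda>t. \<Sum>l<r. if (l, t) \<in> ?I then sq_sing (l, t) else 0) has_sum
      (\<Sum>n=1..q. sq_sing (idx n))) UNIV"
  proof (rule has_sum_finite_neutralI)
    show "finite (snd ` ?I)" by simp
    show "(\<Sum>n=1..q. sq_sing (idx n)) = (\<Sum>t\<in>snd ` ?I. \<Sum>l<r. if (l, t) \<in> ?I then sq_sing (l, t) else 0)"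
    proof -
      have "(\<Sum>t\<in>snd ` ?I. \<Sum>l<r. if (l, t) \<in> ?I then sq_sing (l, t) else 0) =
          (\<Sum>l<r. \<Sum>t\<in>snd ` ?I. if (l, t) \<in> ?I then sq_sing (l, t) else 0)"
        by (rule sum.swap)
      also have "\<dots> = (\<Sum>x\<in>{..<r} \<times> snd ` ?I. if x \<in> ?I then sq_sing x else 0)"
        unfolding sum.cartesian_product by (rule sum.cong) auto
      also have "\<dots> = sum sq_sing ?I"
      proof (rule sum.mono_neutral_cong_right)
        show "?I \<subseteq> {..<r} \<times> snd ` ?I"
        proof
          fix x assume x: "x \<in> ?I"
          hence "fst x < r" using fst_idx_less by auto
          thus "x \<in> {..<r} \<times> snd ` ?I" using x by (simp add: mem_Times_iff)
        qed
      qed auto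
      also have "\<dots> = (\<Sum>n=1..q. sq_sing (idx n))"
        using inj_on_subset[OF inj_idx, of "{1..q}"] by (subst sum.reindex) auto
      finally show ?thesis ..
    qed
    fix t assume t: "t \<in> UNIV - snd ` ?I"
    have "(l, t) \<notin> ?I" for l
    proof
      assume "(l, t) \<in> ?I"
      hence "snd (l, t) \<in> snd ` ?I" by (rule imageI)
      thus False using t by simp
    qed
    thus "(\<Sum>l<r. if (l, t) \<in> ?I then sq_sing (l, t) else 0) = 0" by simp
  qed simp
  from has_sum_add[OF residual_has_sum[of q] this]
  have "((\<lambda>t. \<Sum>l<r. sq_sing (l, t)) has_sum
      (tensor_norm H (X - trunc q))\<^sup>2 + (\<Sum>n=1..q. sq_sing (idx n))) UNIV"
    unfolding sum.distrib[symmetric] by (simp add: if_distrib[of "\<lambda>x. x + _"] cong: if_cong)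
  from has_sum_unique[OF this total_has_sum] show ?thesis by simp
qed

lemma residual_tendsto: "(\<lambda>q. tensor_norm H (X - trunc q)) \<longlonglongrightarrow> 0"
proof -
  have "(\<lambda>q. total - (\<Sum>n=1..q. sq_sing (idx n))) \<longlonglongrightarrow> total - total"
    by (intro tendsto_intros sum_sq_sing_tendsto)
  hence "(\<lambda>q. sqrt ((tensor_norm H (X - trunc q))\<^sup>2)) \<longlonglongrightarrow> sqrt 0"
    by (intro tendsto_real_sqrt) (simp add: residual_norm)
  thus ?thesis by (simp add: tensor_norm_nonneg)
qed

lemma residual_op_tendsto: "(\<lambda>q. tensor_op_norm H (X - trunc q)) \<longlonglongrightarrow> 0"
  by (rule tendsto_sandwich[OF _ _ tendsto_const residual_tendsto])
    (simp_all add: tensor_op_norm_bounds[OF diff_in_hilbert_tensors[OF X trunc_in] pos(2)])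

end


section \<open>Rank\<close>

lemma sum_apply_fun: "sum f F i = (\<Sum>a\<in>F. f a i)"
proof (induction F rule: infinite_finite_induct)
  case (insert a F)
  thus ?case by (simp only: sum.insert plus_fun_apply not_False_eq_True)
qed (simp_all only: sum.infinite sum.empty zero_fun_apply not_False_eq_True)

context based_hilbert
begin

lemma column_smul_apply: "column_smul H c f i = (\<lambda>x. smul H c (f i x))"
  by (simp add: column_smul_def)

sublocale cs: vector_space "column_smul H"
proof
  fix a b :: 'f and f g :: "nat \<Rightarrow> 'h \<Rightarrow> 'h"
  show "column_smul H a (f + g) = column_smul H a f + column_smul H a g"
    by (intro ext) (simp only: column_smul_apply plus_fun_apply hs.scale_right_distrib)
  show "column_smul H (a + b) f = column_smul H a f + column_smul H b f"
    by (intro ext) (simp only: column_smul_apply plus_fun_apply hs.scale_left_distrib)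
  show "column_smul H a (column_smul H b f) = column_smul H (a * b) f"
    by (intro ext) (simp only: column_smul_apply hs.scale_scale)
  show "column_smul H 1 f = f"
    by (intro ext) (simp only: column_smul_apply hs.scale_one)
qed

lemma tensor_rank_leI:
  assumes C: "finite C" "tensor_image H Y \<subseteq> cs.span C"
  shows "tensor_rank H Y \<le> enat (card C)"
proof -
  have "tensor_rank H Y = enat (cs.dim (tensor_image H Y))"
    unfolding tensor_rank_def using C by (intro if_P) (intro exI[of _ C] conjI)
  thus ?thesis using cs.dim_le_card[OF C(2,1)] by simp
qed

text \<open>A finite bound excludes the value \<infinity>, so the image has a finite spanning set. A
  basis chosen inside the image is then finite by the exchange argument, and its size is the
  dimension.\<close>

lemma tensor_rank_leE:
  assumes "tensor_rank H Y \<le> enat q"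
  obtains C where "finite C" "card C \<le> q" "tensor_image H Y \<subseteq> cs.span C"
proof -
  have ex: "\<exists>B. finite B \<and> tensor_image H Y \<subseteq> cs.span B"
  proof (rule ccontr)
    assume "\<not> ?thesis"
    hence "tensor_rank H Y = \<infinity>" unfolding tensor_rank_def by (rule if_not_P)
    thus False using assms by simp
  qed
  hence "tensor_rank H Y = enat (cs.dim (tensor_image H Y))"
    unfolding tensor_rank_def by (rule if_P)
  hence dim: "cs.dim (tensor_image H Y) \<le> q" using assms by simp
  obtain B0 where B0: "finite B0" "tensor_image H Y \<subseteq> cs.span B0" using ex by (elim exE conjE)
  obtain B where B: "B \<subseteq> tensor_image H Y" "cs.independent B" "tensor_image H Y \<subseteq> cs.span B"
    "card B = cs.dim (tensor_image H Y)"
    by (rule cs.basis_exists)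
  have "finite B" using cs.independent_span_bound[OF B0(1) B(2)] B(1) B0(2) by simp
  thus ?thesis using that[of B] B dim by simp
qed

lemma tube_coef_tmult_column:
  assumes Y: "Y \<in> quasi_tensors H m p" and Z: "Z \<in> quasi_tensors H p 1" and i: "i < m"
  shows "tube_coef H (tmult H Y Z $$ (i, 0)) k = (\<Sum>j<p. slice H Y k $$ (i, j) * slice H Z k $$ (j, 0))"
proof -
  have "tube_coef H (tmult H Y Z $$ (i, 0)) k = slice H (tmult H Y Z) k $$ (i, 0)"
    using quasi_tensors_carrier[OF tmult_in[OF Y Z]] i by simp
  also have "\<dots> = (\<Sum>j<p. slice H Y k $$ (i, j) * slice H Z k $$ (j, 0))"
    unfolding slice_tmult[OF Y Z]
    by (rule mult_mat_entry[OF slice_carrier[OF quasi_tensors_carrier[OF Y]]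
        slice_carrier[OF quasi_tensors_carrier[OF Z]] i]) simp
  finally show ?thesis .
qed

lemma smul_star: "(\<lambda>x. smul H c (star H y x)) = star H (smul H c y)"
proof (rule ext, rule coef_eqI)
  show "coef H (smul H c (star H y x)) j = coef H (star H (smul H c y) x) j" for x j
    by (simp only: coef_smul coef_star mult.assoc)
qed

end

lemma sum_single_slice:
  assumes "finite K" "t0 \<in> K"
  shows "(\<Sum>x\<in>I \<times> K. case x of (i, t) \<Rightarrow> if t = t0 then g i else 0) = (\<Sum>i\<in>I. g i)"
  unfolding sum.cartesian_product[symmetric] using assms by (intro sum.cong refl) simp

section \<open>Rank of the truncation and the lower bound for its competitors\<close>

context truncated_svd
begin

text \<open>Each summand of the truncation sends every \<open>Z\<close> to a scalar multiple of one
  fixed column, so \<open>q\<close> columns span the image.\<close>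

lemma trunc_rank: "tensor_rank H (trunc q) \<le> enat q"
proof -
  \<comment> \<open>The left singular vector of the \<open>n\<close>-th pair, placed in its own
    slice and 0 in all others. Rows from \<open>m\<close> on are 0 to match the encoding in
    \<open>tensor_image\<close>.\<close>
  define b where "b n i = (if i < m then star H (smul H (u (snd (idx n)) i (fst (idx n)))
    (bas H (snd (idx n)))) else 0)" for n i
  have T: "trunc q \<in> quasi_tensors H m p" by (rule hilbert_tensors_subset[OF trunc_in])
  have dims: "dim_row (trunc q) = m" "dim_col (trunc q) = p"
    using quasi_tensors_carrier[OF T] by auto
  have "tensor_image H (trunc q) \<subseteq> cs.span (b ` {1..q})"
    unfolding tensor_image_def dims
  proof (rule image_subsetI)
    fix Z assume Z: "Z \<in> quasi_tensors H p 1"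
    \<comment> \<open>The scalar produced by the \<open>n\<close>-th summand: the singular value
      times the inner product of the relevant slice of \<open>Z\<close> with the right singular
      vector.\<close>
    define \<alpha> where "\<alpha> n = sing_val H S (idx n) *
      (\<Sum>j<p. conjugate (v (snd (idx n)) j (fst (idx n))) * slice H Z (snd (idx n)) $$ (j, 0))" for n
    have "(\<lambda>i. if i < m then tmult H (trunc q) Z $$ (i, 0) else 0) =
        (\<Sum>n=1..q. column_smul H (\<alpha> n) (b n))"
    proof (rule ext)
      fix i
      show "(if i < m then tmult H (trunc q) Z $$ (i, 0) else 0) =
          (\<Sum>n=1..q. column_smul H (\<alpha> n) (b n)) i"
      proof (cases "i < m")
        case True
        have "(\<Sum>n=1..q. column_smul H (\<alpha> n) (b n)) i = star H (\<Sum>n=1..q. smul H (\<alpha> n)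
            (smul H (u (snd (idx n)) i (fst (idx n))) (bas H (snd (idx n)))))" (is "_ = star H ?y")
          unfolding sum_apply_fun column_smul_apply b_def if_P[OF True] smul_star star_sum ..
        moreover have "tmult H (trunc q) Z $$ (i, 0) = star H ?y"
        proof (rule quasitube_eqI)
          show "tmult H (trunc q) Z $$ (i, 0) \<in> quasitubes H"
            using tmult_in[OF T Z] True by (simp add: quasi_tensors_iff)
          fix k
          let ?c = "\<lambda>n. if snd (idx n) = k
            then sing_val H S (idx n) * u k i (fst (idx n)) else 0"
          have "tube_coef H (tmult H (trunc q) Z $$ (i, 0)) k =
              (\<Sum>j<p. (\<Sum>n=1..q. if snd (idx n) = k
    then sing_val H S (idx n) * u k i (fst (idx n)) * conjugate (v k j (fst (idx n))) else 0)
                * slice H Z k $$ (j, 0))"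
            unfolding tube_coef_tmult_column[OF T Z True]
            by (intro sum.cong refl) (simp only: slice_trunc[OF True] lessThan_iff)
          also have "\<dots> = (\<Sum>n=1..q. \<Sum>j<p. (if snd (idx n) = k
    then sing_val H S (idx n) * u k i (fst (idx n)) * conjugate (v k j (fst (idx n))) else 0)
                * slice H Z k $$ (j, 0))"
            unfolding sum_distrib_right by (rule sum.swap)
          also have "\<dots> = tube_coef H (star H ?y) k"
            unfolding tube_coef_star coef_sum coef_smul coef_bas \<alpha>_def
          proof (rule sum.cong[OF refl])
            fix n
            show "(\<Sum>j<p. (if snd (idx n) = k
    then sing_val H S (idx n) * u k i (fst (idx n)) * conjugate (v k j (fst (idx n))) else 0)
                * slice H Z k $$ (j, 0)) =
              sing_val H S (idx n) *
      (\<Sum>j<p. conjugate (v (snd (idx n)) j (fst (idx n))) * slice H Z (snd (idx n)) $$ (j, 0)) *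
         (u (snd (idx n)) i (fst (idx n)) * (if snd (idx n) = k then 1 else 0))"
            proof (cases "snd (idx n) = k")
              case True
              have "(\<Sum>j<p. sing_val H S (idx n) * u k i (fst (idx n)) * conjugate (v k j (fst (idx n)))
                  * slice H Z k $$ (j, 0)) = sing_val H S (idx n) * u k i (fst (idx n)) *
                (\<Sum>j<p. conjugate (v k j (fst (idx n))) * slice H Z k $$ (j, 0))"
                unfolding sum_distrib_left by (rule sum.cong[OF refl]) (simp only: mult.assoc)
              thus ?thesis
                unfolding True if_P[OF True] if_P[OF refl] mult_1_right by (simp only: mult_ac)
            qed simp
          qed
          finally show "tube_coef H (tmult H (trunc q) Z $$ (i, 0)) k = tube_coef H (star H ?y) k" .
        qed (rule star_in_quasitubes)
        ultimately show ?thesis unfolding if_P[OF True] by (simp only:)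
      next
        case False
        have "column_smul H (\<alpha> n) (b n) i = 0" for n
          by (rule ext)
            (simp only: column_smul_apply b_def if_not_P[OF False] zero_fun_apply hs.scale_zero_right)
        hence "(\<Sum>n=1..q. column_smul H (\<alpha> n) (b n)) i = 0"
          by (subst sum_apply_fun) (intro sum.neutral ballI)
        thus ?thesis unfolding if_not_P[OF False] by (rule sym)
      qed
    qed
    also have "\<dots> \<in> cs.span (b ` {1..q})"
      by (intro cs.span_sum cs.span_scale cs.span_base imageI)
    finally show "(\<lambda>i. if i < m then tmult H (trunc q) Z $$ (i, 0) else 0) \<in> cs.span (b ` {1..q})" .
  qed
  from tensor_rank_leI[OF _ this] have "tensor_rank H (trunc q) \<le> enat (card (b ` {1..q}))" by simp
  also have "\<dots> \<le> enat q" using card_image_le[of "{1..q}" b] by simp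
  finally show ?thesis .
qed

text \<open>The cut-off \<open>N\<close> confines the argument to finitely many slices, hence to
  functions on a finite set \<open>A\<close>. The bound on the right does not depend on
  \<open>N\<close>, which leaves the limit for later.\<close>

lemma sum_sq_sing_le:
  assumes Y: "Y \<in> hilbert_tensors H m p" and rank: "tensor_rank H Y \<le> enat q" and q: "1 \<le> q"
  shows "(\<Sum>n=1..N. sq_sing (idx n)) - (\<Sum>n=1..q. sq_sing (idx n)) \<le> (tensor_norm H (X - Y))\<^sup>2"
proof -
  have Yq: "Y \<in> quasi_tensors H m p" by (rule hilbert_tensors_subset[OF Y])
  have dims: "dim_row Y = m" "dim_col Y = p" using quasi_tensors_carrier[OF Yq] by auto
  define K where "K = snd ` idx ` {1..N}"
  define A where "A = {..<m} \<times> K"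
  define L T where "L n = fst (idx n)" and "T n = snd (idx n)" for n
  have K: "finite K" by (simp add: K_def)
  have A: "finite A" by (simp add: A_def K)
  have T: "T n \<in> K" if "n \<in> {1..N}" for n using that by (simp add: K_def T_def)
  have L: "L n < m" "L n < p" if "n \<in> {1..N}" for n
    using that fst_idx_less[of n] by (simp_all add: L_def)
  \<comment> \<open>The left singular vector of the \<open>n\<close>-th pair as a function on all of
    \<open>A\<close>, extended by 0 to the other slices.\<close>
  define w where "w n = (\<lambda>(i, t). if t = T n then u t i (L n) else 0)" for n
  \<comment> \<open>Coordinates of a column. They are linear in \<open>f\<close>, so generators of
    the image yield generators of its coordinate functions.\<close>
  define \<rho> :: "(nat \<Rightarrow> 'h \<Rightarrow> 'h) \<Rightarrow> nat \<times> int \<Rightarrow> 'f"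
    where "\<rho> f = (\<lambda>(i, t). tube_coef H (f i) t)" for f

  have on: "orthonormal_on A {1..N} w"
    unfolding orthonormal_on_def
  proof (intro ballI)
    fix n n' assume n: "n \<in> {1..N}" and n': "n' \<in> {1..N}"
    \<comment> \<open>Within one slice this is orthonormality of the columns of \<open>U\<close>;
      vectors from different slices have disjoint supports.\<close>
    show "cdot A (w n) (w n') = (if n = n' then 1 else 0)"
    proof (cases "T n = T n'")
      case True
      have "cdot A (w n) (w n') = (\<Sum>x\<in>{..<m} \<times> K. case x of (i, t) \<Rightarrow>
          if t = T n then u (T n) i (L n) * conjugate (u (T n) i (L n')) else 0)"
        unfolding cdot_def A_def w_def using True by (intro sum.cong refl) auto
      also have "\<dots> = (if L n = L n' then 1 else 0)"
        unfolding sum_single_slice[OF K T[OF n]] by (rule unitary_columns[OF U L(1)[OF n] L(1)[OF n']])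
      also have "L n = L n' \<longleftrightarrow> n = n'"
      proof
        assume "L n = L n'"
        hence "idx n = idx n'" using True by (simp add: L_def T_def prod_eq_iff)
        thus "n = n'" using inj_onD[OF inj_idx] n n' by simp
      qed simp
      finally show ?thesis .
    next
      case False
      hence "cdot A (w n) (w n') = 0"
        unfolding cdot_def w_def by (intro sum.neutral) auto
      thus ?thesis using False by auto
    qed
  qed
  have norm_w: "(\<Sum>a\<in>A. (norm (w n a))\<^sup>2) = 1" if "n \<in> {1..N}" for n
  proof -
    have "cdot A (w n) (w n) = of_real 1" using on that by (simp add: orthonormal_on_def)
    thus ?thesis unfolding cdot_self of_real_eq_iff .
  qed

  obtain C where C: "finite C" "card C \<le> q" "tensor_image H Y \<subseteq> cs.span C"
    using rank by (rule tensor_rank_leE)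
  obtain W where W: "finite W" "card W \<le> card (\<rho> ` C)" "orthonormal_on A W (\<lambda>w. w)"
    and W_C: "\<And>b a. b \<in> \<rho> ` C \<Longrightarrow> a \<in> A \<Longrightarrow> b a = (\<Sum>w\<in>W. cdot A b w * w a)"
  proof (rule gram_schmidt_functions[OF A finite_imageI[OF C(1), of \<rho>]])
    fix W assume W: "finite W" "card W \<le> card (\<rho> ` C)" "orthonormal_on A W (\<lambda>w. w)"
      "\<And>b a. b \<in> \<rho> ` C \<Longrightarrow> a \<in> A \<Longrightarrow> b a = (\<Sum>w\<in>W. cdot A b w * w a)"
    show thesis by (rule that[OF W])
  qed
  have card_W: "card W \<le> q" using W(2) card_image_le[OF C(1), of \<rho>] C(2) by simp

  \<comment> \<open>Gram-Schmidt expands only the generators. The columns whose coordinates expand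
    in \<open>W\<close> form a subspace, which therefore contains the whole image of
    \<open>Y\<close>.\<close>
  let ?P = "{f. \<forall>a\<in>A. \<rho> f a = (\<Sum>w\<in>W. cdot A (\<rho> f) w * w a)}"
  have \<rho>_add: "\<rho> (f + g) = (\<lambda>a. \<rho> f a + \<rho> g a)" for f g
    by (auto simp: \<rho>_def)
  have \<rho>_smul: "\<rho> (column_smul H c f) = (\<lambda>a. c * \<rho> f a)" for c f
    by (auto simp: \<rho>_def column_smul_apply)
  have \<rho>_zero: "\<rho> 0 = (\<lambda>a. 0)"
    by (auto simp: \<rho>_def)
  have "cs.span C \<subseteq> ?P"
  proof (rule cs.span_minimal)
    show "C \<subseteq> ?P" using W_C by auto
    show "cs.subspace ?P"
    proof (rule cs.subspaceI)
      show "0 \<in> ?P" unfolding mem_Collect_eq \<rho>_zero by (simp add: cdot_def)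
      show "f + g \<in> ?P" if "f \<in> ?P" "g \<in> ?P" for f g
        using that unfolding mem_Collect_eq \<rho>_add by (simp add: cdot_add_left distrib_right sum.distrib)
      show "column_smul H c f \<in> ?P" if "f \<in> ?P" for c f
        using that unfolding mem_Collect_eq \<rho>_smul by (simp add: cdot_scale_left sum_distrib_left mult.assoc)
    qed
  qed
  hence image: "\<rho> f a = (\<Sum>w\<in>W. cdot A (\<rho> f) w * w a)" if "f \<in> tensor_image H Y" "a \<in> A" for f a
    using that C(3) by auto

  define c where "c n = (\<Sum>w'\<in>W. (norm (cdot A (w n) w'))\<^sup>2)" for n
  define d where "d x = (\<Sum>i<m. (norm (\<Sum>j<p. slice H (X - Y) (snd x) $$ (i, j) * v (snd x) j (fst x)))\<^sup>2)"
    for x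
  have key: "sq_sing (idx n) * (1 - c n) \<le> d (idx n)" if n: "n \<in> {1..N}" for n
  proof -
    \<comment> \<open>A column carrying the right singular vector in slice \<open>T n\<close> and 0
      elsewhere. Its image under \<open>Y\<close> lives in that slice alone, as \<open>w n\<close>
      does.\<close>
    define Z where "Z = Matrix.mat p 1 (\<lambda>(j, _). star H (smul H (v (T n) j (L n)) (bas H (T n))))"
    have Z: "Z \<in> quasi_tensors H p 1" by (simp add: quasi_tensors_iff Z_def)
    have Z_entry: "slice H Z t $$ (j, 0) = (if t = T n then v (T n) j (L n) else 0)" if "j < p" for t j
      using that by (simp add: Z_def coef_bas)
    define f where "f i = (if i < m then tmult H Y Z $$ (i, 0) else 0)" for i
    have f: "f \<in> tensor_image H Y"
      unfolding tensor_image_def dims f_def[abs_def] using Z by (rule imageI)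
    have f_entry: "\<rho> f (i, t) = (if t = T n then \<Sum>j<p. slice H Y t $$ (i, j) * v t j (L n) else 0)"
      if "i < m" for i t
    proof -
      have "\<rho> f (i, t) = tube_coef H (tmult H Y Z $$ (i, 0)) t" using that by (simp add: \<rho>_def f_def)
      also have "\<dots> = (\<Sum>j<p. slice H Y t $$ (i, j) * (if t = T n then v (T n) j (L n) else 0))"
        unfolding tube_coef_tmult_column[OF Yq Z that]
        by (intro sum.cong refl) (simp only: Z_entry lessThan_iff)
      finally show ?thesis by auto
    qed
    let ?s = "sing_val H S (idx n)"
    \<comment> \<open>Scaling the unit vector \<open>w n\<close> by \<open>?s\<close> multiplies
      both its squared length and its squared projection by \<open>sq_sing (idx n)\<close>.\<close>
    have "sq_sing (idx n) * (1 - c n) =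
        (\<Sum>a\<in>A. (norm (?s * w n a))\<^sup>2) - (\<Sum>w'\<in>W. (norm (cdot A (\<lambda>a. ?s * w n a) w'))\<^sup>2)"
      by (simp only: cdot_scale_left norm_mult power_mult_distrib sum_distrib_left[symmetric]
          norm_w[OF n] c_def sq_sing_def right_diff_distrib)
    also have "\<dots> \<le> (\<Sum>a\<in>A. (norm (?s * w n a - \<rho> f a))\<^sup>2)"
      by (rule distance_to_span_ge[OF W(1,3) image[OF f]])
    also have "\<dots> = (\<Sum>x\<in>{..<m} \<times> K. case x of (i, t) \<Rightarrow> if t = T n
        then (norm (\<Sum>j<p. slice H (X - Y) (T n) $$ (i, j) * v (T n) j (L n)))\<^sup>2 else 0)"
      unfolding A_def
    proof (rule sum.cong[OF refl])
      fix x assume "x \<in> {..<m} \<times> K"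
      then obtain i t where x: "x = (i, t)" and i: "i < m" by auto
      have "?s * w n (i, t) - \<rho> f (i, t) =
          (if t = T n then \<Sum>j<p. slice H (X - Y) (T n) $$ (i, j) * v (T n) j (L n) else 0)"
      proof (cases "t = T n")
        case True
        have "(\<Sum>j<p. slice H (X - Y) (T n) $$ (i, j) * v (T n) j (L n)) =
          sing_val H S (L n, T n) * u (T n) i (L n) - (\<Sum>j<p. slice H Y (T n) $$ (i, j) * v (T n) j (L n))"
          unfolding sum_diff_slice[OF Y i] X_mult_v[OF i L(2)[OF n]] if_P[OF L(1)[OF n]] ..
        moreover have "(L n, T n) = idx n" by (simp add: L_def T_def)
        ultimately show ?thesis using True by (simp add: w_def f_entry[OF i])
      next
        case False
        thus ?thesis by (simp add: w_def f_entry[OF i])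
      qed
      thus "(norm (?s * w n x - \<rho> f x))\<^sup>2 = (case x of (i, t) \<Rightarrow> if t = T n
        then (norm (\<Sum>j<p. slice H (X - Y) (T n) $$ (i, j) * v (T n) j (L n)))\<^sup>2 else 0)"
        unfolding x by simp
    qed
    also have "\<dots> = d (idx n)"
      unfolding sum_single_slice[OF K T[OF n]] unfolding d_def L_def T_def ..
    finally show ?thesis .
  qed

  have "(\<Sum>n=1..N. sq_sing (idx n)) - (\<Sum>n=1..q. sq_sing (idx n)) \<le>
      (\<Sum>n=1..N. sq_sing (idx n) * (1 - c n))"
  proof (rule sum_tail_le_weighted)
    show "sq_sing (idx k) \<le> sq_sing (idx n)" if "1 \<le> n" "n \<le> k" for n k
      using that by (rule sq_sing_antimono)
    show "0 \<le> c n" for n by (simp add: c_def sum_nonneg)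
    show "c n \<le> 1" if "n \<in> {1..N}" for n
      using bessel_inequality[OF W(1,3), of "w n"] norm_w[OF that] by (simp add: c_def)
    \<comment> \<open>The roles in Bessel's inequality are exchanged: the family \<open>w\<close> is
      now the orthonormal system and each \<open>w'\<close> the unit vector, so every element of
      \<open>W\<close> contributes at most 1.\<close>
    have "(\<Sum>n=1..N. c n) = (\<Sum>w'\<in>W. \<Sum>n=1..N. (norm (cdot A w' (w n)))\<^sup>2)"
      unfolding c_def
      by (subst sum.swap) (intro sum.cong refl, subst cdot_commute, simp only: norm_conjugate)
    also have "\<dots> \<le> (\<Sum>w'\<in>W. 1)"
    proof (rule sum_mono)
      fix w' assume "w' \<in> W"
      hence "cdot A w' w' = of_real 1" using W(3) by (simp add: orthonormal_on_def)
      hence "(\<Sum>a\<in>A. (norm (w' a))\<^sup>2) = 1" unfolding cdot_self of_real_eq_iff .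
      thus "(\<Sum>n=1..N. (norm (cdot A w' (w n)))\<^sup>2) \<le> 1"
        using bessel_inequality[OF _ on, of w'] by simp
    qed
    also have "\<dots> \<le> real q" using card_W by simp
    finally show "(\<Sum>n=1..N. c n) \<le> real q" .
  qed (use q sq_sing_nonneg in auto)
  also have "\<dots> \<le> (\<Sum>n=1..N. d (idx n))" by (intro sum_mono key)
  also have "\<dots> = sum d (idx ` {1..N})"
    using inj_on_subset[OF inj_idx, of "{1..N}"] by (subst sum.reindex) auto
  \<comment> \<open>The added terms are non-negative and complete the set of columns in each slice
    of \<open>K\<close>, so that the inner sums become Frobenius norms.\<close>
  also have "\<dots> \<le> sum d ({..<p} \<times> K)"
  proof (rule sum_mono2)
    show "idx ` {1..N} \<subseteq> {..<p} \<times> K"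
    proof (rule image_subsetI)
      fix n assume "n \<in> {1..N}"
      thus "idx n \<in> {..<p} \<times> K" using L(2)[of n] T[of n] by (simp add: mem_Times_iff L_def T_def)
    qed
  qed (auto simp: K d_def sum_nonneg)
  also have "\<dots> = (\<Sum>l<p. \<Sum>t\<in>K. d (l, t))"
    unfolding sum.cartesian_product by (rule sum.cong) auto
  also have "\<dots> = (\<Sum>t\<in>K. \<Sum>l<p. d (l, t))"
    by (rule sum.swap)
  also have "\<dots> = (\<Sum>t\<in>K. frobenius_sq (slice H (X - Y) t))"
    unfolding frobenius_sq_slice[OF diff_in_hilbert_tensors[OF X Y]] d_def fst_conv snd_conv ..
  also have "\<dots> \<le> (tensor_norm H (X - Y))\<^sup>2"
    by (rule sum_frobenius_sq_slice_le[OF diff_in_hilbert_tensors[OF X Y] K])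
  finally show ?thesis .
qed

text \<open>As \<open>N\<close> tends to infinity in \<open>sum_sq_sing_le\<close>, the left-hand
  side becomes the squared norm of the residual.\<close>

lemma trunc_optimal:
  assumes "Y \<in> hilbert_tensors H m p" "tensor_rank H Y \<le> enat q" "1 \<le> q"
  shows "tensor_norm H (X - trunc q) \<le> tensor_norm H (X - Y)"
proof -
  have "(\<lambda>N. (\<Sum>n=1..N. sq_sing (idx n)) - (\<Sum>n=1..q. sq_sing (idx n))) \<longlonglongrightarrow>
      total - (\<Sum>n=1..q. sq_sing (idx n))"
    by (intro tendsto_intros sum_sq_sing_tendsto)
  hence "total - (\<Sum>n=1..q. sq_sing (idx n)) \<le> (tensor_norm H (X - Y))\<^sup>2"
    by (rule LIMSEQ_le_const2) (use sum_sq_sing_le[OF assms] in auto)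
  thus ?thesis
    unfolding residual_norm[symmetric] by (rule power2_le_imp_le) (rule tensor_norm_nonneg)
qed

end

theorem theorem7p1:
  fixes H :: "('f::real_or_complex, 'h::banach) based_space"
    and m p :: nat
    and X U S V :: "('h \<Rightarrow> 'h) mat"
    and idx :: "nat \<Rightarrow> nat \<times> int"
  assumes "based_hilbert_space H"
    and "0 < m" and "0 < p"
    and "X \<in> hilbert_tensors H m p"
    and "qsvd H m p X U S V"
    and "sing_val_enum H m p S idx"
  shows "(\<forall>q\<ge>1.
            truncation H U S V idx q \<in> hilbert_tensors H m p \<and>
            tensor_rank H (truncation H U S V idx q) \<le> enat q \<and>
            (\<forall>Y\<in>hilbert_tensors H m p. tensor_rank H Y \<le> enat q \<longrightarrow>
               tensor_norm H (X - truncation H U S V idx q) \<le> tensor_norm H (X - Y))) \<and>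
         (\<lambda>q. tensor_op_norm H (X - truncation H U S V idx q)) \<longlonglongrightarrow> 0 \<and>
         (\<lambda>q. tensor_norm H (X - truncation H U S V idx q)) \<longlonglongrightarrow> 0"
proof -
  interpret truncated_svd H m p X U S V idx
    using assms by unfold_locales
  show ?thesis
    by (intro conjI allI ballI impI trunc_in trunc_rank trunc_optimal residual_op_tendsto
        residual_tendsto)
qed

end
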